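(* Let $M$ be a countable transitive model of ZFC and $\Gamma$ a class of forcings such that $\mathbb{M}=\mathbb{M}^\Gamma_M$ is $\sigma$-closed. Let $N\in\mathbb{M}$ be infinitely generic in the multiverse and let $\varphi$ be a formula with parameters in $N$. If there is $N'\in\mathbb{M}$ with $N'\le N$ such that $N'\models\varphi$ and $N''\models\varphi$ for every $N''\in\mathbb{M}$ with $N''\le N'$, then $N\models\varphi$.
   Context: $M$ is a countable transitive model of ZFC and $\Gamma$ is a class of forcing notions defined by a first-order formula $\varphi_\Gamma$ of set theory; $\Gamma^N$ denotes the posets of $N$ satisfying $\varphi_\Gamma$ relativized to $N$. $\Gamma$ contains the trivial forcing and is closed under two-step iterations. $\mathbb{M}=\mathbb{M}^\Gamma_M$ is the collection of all generic extensions of $M$ by posets in $\Gamma^M$; for $N,N'\in\mathbb{M}$, $N'\le N$ means $N'$ is a generic extension of $N$ by some $\mathbb{P}\in\Gamma^N$. $\sigma$-closed: every sequence $N_0\ge N_1\ge\cdots$ in $\mathbb{M}$ has a lower bound in $\mathbb{M}$. Infinite multiverse forcing $N\Vdash\varphi$ ($N\in\mathbb{M}$, $\varphi$ a formula with parameters in $N$, built with $\wedge,\vee,\neg,\exists$; $\forall,\to$ abbreviations): atomic $\varphi$: $N\Vdash\varphi$ iff $N\models\varphi$; $N\Vdash\varphi\wedge\psi$ iff both; $N\Vdash\varphi\vee\psi$ iff at least one; $N\Vdash\exists x\varphi(x)$ iff $N\Vdash\varphi(a)$ for some $a\in N$; $N\Vdash\neg\varphi$ iff there is no $Q\in\mathbb{M}$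 with $Q\le N$ and $Q\Vdash\varphi$. $N$ is infinitely generic in the multiverse if for every sentence $\varphi$ with parameters in $N$, $N\Vdash\varphi$ or $N\Vdash\neg\varphi$. *)

theory Defs
  imports Main "HOL-Library.Countable_Set_Type"
begin

text \<open>
  The ambient universe. The type \<open>hc\<close> consists of the hereditarily countable sets: its elements
  are the well-founded extensional sets all of whose elements are again in \<open>hc\<close> and which are
  countable. Every countable transitive set is a subset of this universe, so countable transitive
  models, their elements, the filters generic over them and their generic extensions all live in it.
\<close>

datatype hc = HC "hc cset"

definition elts :: "hc \<Rightarrow> hc set" where
  "elts x = (case x of HC A \<Rightarrow> rcset A)"

text \<open>Only meaningful for countable \<open>A\<close>.\<close>

definition hset :: "hc set \<Rightarrow> hc" where
  "hset A = HC (acset A)"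

lemma countable_elts [simp]: "countable (elts x)"
  by (cases x) (simp add: elts_def)

lemma elts_hset [simp]: "countable A \<Longrightarrow> elts (hset A) = A"
  by (simp add: elts_def hset_def acset_inverse)

lemma hset_elts [simp]: "hset (elts x) = x"
  by (cases x) (simp add: elts_def hset_def rcset_inverse)

lemma hc_ext: "x = y \<longleftrightarrow> elts x = elts y"
  by (metis hset_elts)

lemma hc_induct:
  assumes step: "\<And>x. (\<And>y. y \<in> elts x \<Longrightarrow> P y) \<Longrightarrow> P x"
  shows "P x"
proof (induction x rule: hc.induct)
  case (HC A)
  show ?case
  proof (rule step)
    fix y assume "y \<in> elts (HC A)"
    then show "P y"
      by (intro HC.IH) (simp add: elts_def)
  qed
qed

lemma wf_elts: "wf {(y, x). y \<in> elts x}"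
  unfolding wf_def by (auto intro: hc_induct)

text \<open>Kuratowski pairs.\<close>

definition kpair :: "hc \<Rightarrow> hc \<Rightarrow> hc" where
  "kpair x y = hset {hset {x}, hset {x, y}}"

lemma kpair_inject [simp]: "kpair a b = kpair c d \<longleftrightarrow> a = c \<and> b = d"
proof -
  have inj: "hset A = hset B \<longleftrightarrow> A = B" if "countable A" "countable B" for A B
    using that by (metis elts_hset)
  show ?thesis
    by (simp add: kpair_def inj doubleton_eq_iff) blast
qed

definition ktriple :: "hc \<Rightarrow> hc \<Rightarrow> hc \<Rightarrow> hc" where
  "ktriple x y z = kpair x (kpair y z)"

section \<open>First-order formulas of set theory\<close>

text \<open>
  Variables are de Bruijn indices. A formula with parameters in \<open>N\<close> is given by a formula together
  with an assignment of elements of \<open>N\<close> to its free variables.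
\<close>

datatype fm = Mem nat nat | Equal nat nat | And fm fm | Or fm fm | Neg fm | Exi fm

primrec sat :: "hc set \<Rightarrow> (nat \<Rightarrow> hc) \<Rightarrow> fm \<Rightarrow> bool" where
  "sat N e (Mem i j) \<longleftrightarrow> e i \<in> elts (e j)"
| "sat N e (Equal i j) \<longleftrightarrow> e i = e j"
| "sat N e (And \<phi> \<psi>) \<longleftrightarrow> sat N e \<phi> \<and> sat N e \<psi>"
| "sat N e (Or \<phi> \<psi>) \<longleftrightarrow> sat N e \<phi> \<or> sat N e \<psi>"
| "sat N e (Neg \<phi>) \<longleftrightarrow> \<not> sat N e \<phi>"
| "sat N e (Exi \<phi>) \<longleftrightarrow> (\<exists>a\<in>N. sat N (case_nat a e) \<phi>)"

definition assignment_in :: "hc set \<Rightarrow> (nat \<Rightarrow> hc) \<Rightarrow> bool" where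
  "assignment_in N e \<longleftrightarrow> (\<forall>i. e i \<in> N)"

section \<open>Countable transitive models of ZFC\<close>

text \<open>The axioms of ZFC, relativized to a class \<open>M\<close> of sets.\<close>

definition ax_extensionality :: "hc set \<Rightarrow> bool" where
  "ax_extensionality M \<longleftrightarrow>
    (\<forall>x\<in>M. \<forall>y\<in>M. (\<forall>z\<in>M. z \<in> elts x \<longleftrightarrow> z \<in> elts y) \<longrightarrow> x = y)"

definition ax_foundation :: "hc set \<Rightarrow> bool" where
  "ax_foundation M \<longleftrightarrow>
    (\<forall>x\<in>M. (\<exists>y\<in>M. y \<in> elts x) \<longrightarrow>
      (\<exists>y\<in>M. y \<in> elts x \<and> \<not> (\<exists>z\<in>M. z \<in> elts x \<and> z \<in> elts y)))"

definition ax_pairing :: "hc set \<Rightarrow> bool" where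
  "ax_pairing M \<longleftrightarrow> (\<forall>x\<in>M. \<forall>y\<in>M. \<exists>u\<in>M. \<forall>z\<in>M. z \<in> elts u \<longleftrightarrow> z = x \<or> z = y)"

definition ax_union :: "hc set \<Rightarrow> bool" where
  "ax_union M \<longleftrightarrow>
    (\<forall>x\<in>M. \<exists>u\<in>M. \<forall>z\<in>M. z \<in> elts u \<longleftrightarrow> (\<exists>y\<in>M. y \<in> elts x \<and> z \<in> elts y))"

definition ax_power_set :: "hc set \<Rightarrow> bool" where
  "ax_power_set M \<longleftrightarrow>
    (\<forall>x\<in>M. \<exists>u\<in>M. \<forall>z\<in>M. z \<in> elts u \<longleftrightarrow> (\<forall>w\<in>M. w \<in> elts z \<longrightarrow> w \<in> elts x))"

definition ax_infinity :: "hc set \<Rightarrow> bool" where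
  "ax_infinity M \<longleftrightarrow>
    (\<exists>u\<in>M. (\<exists>z\<in>M. z \<in> elts u \<and> (\<forall>w\<in>M. w \<notin> elts z)) \<and>
      (\<forall>x\<in>M. x \<in> elts u \<longrightarrow>
        (\<exists>y\<in>M. y \<in> elts u \<and> (\<forall>w\<in>M. w \<in> elts y \<longleftrightarrow> w \<in> elts x \<or> w = x))))"

definition ax_separation :: "hc set \<Rightarrow> bool" where
  "ax_separation M \<longleftrightarrow>
    (\<forall>\<phi> e. assignment_in M e \<longrightarrow>
      (\<forall>x\<in>M. \<exists>u\<in>M. \<forall>z\<in>M. z \<in> elts u \<longleftrightarrow> z \<in> elts x \<and> sat M (case_nat z e) \<phi>))"

definition ax_replacement :: "hc set \<Rightarrow> bool" where
  "ax_replacement M \<longleftrightarrow>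
    (\<forall>\<phi> e. assignment_in M e \<longrightarrow>
      (\<forall>x\<in>M. (\<forall>z\<in>M. z \<in> elts x \<longrightarrow> (\<exists>!y. y \<in> M \<and> sat M (case_nat z (case_nat y e)) \<phi>)) \<longrightarrow>
        (\<exists>u\<in>M. \<forall>z\<in>M. z \<in> elts x \<longrightarrow>
          (\<exists>y\<in>M. y \<in> elts u \<and> sat M (case_nat z (case_nat y e)) \<phi>))))"

text \<open>Choice: every family of nonempty pairwise disjoint sets has a transversal.\<close>

definition ax_choice :: "hc set \<Rightarrow> bool" where
  "ax_choice M \<longleftrightarrow>
    (\<forall>x\<in>M.
      (\<forall>y\<in>M. y \<in> elts x \<longrightarrow> (\<exists>z\<in>M. z \<in> elts y)) \<and>
      (\<forall>y\<in>M. \<forall>y'\<in>M. y \<in> elts x \<and> y' \<in> elts x \<and> y \<noteq> y' \<longrightarrow>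
        \<not> (\<exists>z\<in>M. z \<in> elts y \<and> z \<in> elts y')) \<longrightarrow>
      (\<exists>c\<in>M. \<forall>y\<in>M. y \<in> elts x \<longrightarrow> (\<exists>!z. z \<in> M \<and> z \<in> elts y \<and> z \<in> elts c)))"

definition models_ZFC :: "hc set \<Rightarrow> bool" where
  "models_ZFC M \<longleftrightarrow>
    ax_extensionality M \<and> ax_foundation M \<and> ax_pairing M \<and> ax_union M \<and> ax_power_set M \<and>
    ax_infinity M \<and> ax_separation M \<and> ax_replacement M \<and> ax_choice M"

definition ctm_ZFC :: "hc set \<Rightarrow> bool" where
  "ctm_ZFC M \<longleftrightarrow> countable M \<and> (\<forall>x\<in>M. elts x \<subseteq> M) \<and> models_ZFC M"

section \<open>Forcing notions, names and generic extensions\<close>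

text \<open>
  A forcing notion is a preordered set \<open>P\<close> with a designated largest element \<open>o1\<close>; as a set it is
  the triple \<open>ktriple P le o1\<close>, where \<open>le\<close> is the set of pairs \<open>(p, q)\<close> such that \<open>p\<close> is
  stronger than \<open>q\<close>.
\<close>

definition forcing_notion :: "hc \<Rightarrow> hc \<Rightarrow> hc \<Rightarrow> bool" where
  "forcing_notion P le o1 \<longleftrightarrow>
    (\<forall>x\<in>elts le. \<exists>p\<in>elts P. \<exists>q\<in>elts P. x = kpair p q) \<and>
    (\<forall>p\<in>elts P. kpair p p \<in> elts le) \<and>
    (\<forall>p q r. kpair p q \<in> elts le \<and> kpair q r \<in> elts le \<longrightarrow> kpair p r \<in> elts le) \<and>
    o1 \<in> elts P \<and> (\<forall>p\<in>elts P. kpair p o1 \<in> elts le)"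

definition is_filter :: "hc \<Rightarrow> hc \<Rightarrow> hc \<Rightarrow> hc set \<Rightarrow> bool" where
  "is_filter P le o1 G \<longleftrightarrow>
    G \<subseteq> elts P \<and> o1 \<in> G \<and>
    (\<forall>p\<in>G. \<forall>q\<in>elts P. kpair p q \<in> elts le \<longrightarrow> q \<in> G) \<and>
    (\<forall>p\<in>G. \<forall>q\<in>G. \<exists>r\<in>G. kpair r p \<in> elts le \<and> kpair r q \<in> elts le)"

definition dense_in :: "hc \<Rightarrow> hc \<Rightarrow> hc \<Rightarrow> bool" where
  "dense_in P le D \<longleftrightarrow>
    elts D \<subseteq> elts P \<and> (\<forall>p\<in>elts P. \<exists>d\<in>elts D. kpair d p \<in> elts le)"

definition generic_over :: "hc set \<Rightarrow> hc \<Rightarrow> hc \<Rightarrow> hc \<Rightarrow> hc set \<Rightarrow> bool" where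
  "generic_over N P le o1 G \<longleftrightarrow>
    is_filter P le o1 G \<and> (\<forall>D\<in>N. dense_in P le D \<longrightarrow> G \<inter> elts D \<noteq> {})"

inductive is_name :: "hc \<Rightarrow> hc \<Rightarrow> bool" for P where
  "(\<And>x. x \<in> elts \<tau> \<Longrightarrow> \<exists>\<sigma> p. x = kpair \<sigma> p \<and> p \<in> elts P \<and> is_name P \<sigma>) \<Longrightarrow> is_name P \<tau>"

definition name_dom :: "hc \<Rightarrow> hc set" where
  "name_dom \<tau> = {\<sigma>. \<exists>p. kpair \<sigma> p \<in> elts \<tau>}"

lemma name_dom_trancl:
  assumes "kpair \<sigma> p \<in> elts \<tau>"
  shows "(\<sigma>, \<tau>) \<in> {(y, x). y \<in> elts x}\<^sup>+"
proof -
  have "(\<sigma>, hset {\<sigma>}) \<in> {(y, x). y \<in> elts x}" "(hset {\<sigma>}, kpair \<sigma> p) \<in> {(y, x). y \<in> elts x}"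
    "(kpair \<sigma> p, \<tau>) \<in> {(y, x). y \<in> elts x}"
    using assms by (simp_all add: kpair_def)
  then show ?thesis
    by (rule trancl_into_trancl[OF trancl_into_trancl[OF r_into_trancl]])
qed

text \<open>Evaluation of names: \<open>val G \<tau> = {val G \<sigma> | \<exists>p\<in>G. (\<sigma>, p) \<in> \<tau>}\<close>.\<close>

function val :: "hc set \<Rightarrow> hc \<Rightarrow> hc" where
  "val G \<tau> = hset ((\<lambda>\<sigma>. val G \<sigma>) ` {\<sigma>. \<exists>p\<in>G. kpair \<sigma> p \<in> elts \<tau>})"
  by auto
termination
proof (relation "inv_image ({(y, x). y \<in> elts x}\<^sup>+) snd")
  show "wf (inv_image ({(y, x). y \<in> elts x}\<^sup>+) (snd :: hc set \<times> hc \<Rightarrow> hc))"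
    by (intro wf_inv_image wf_trancl wf_elts)
next
  fix G :: "hc set" and \<tau> \<sigma> :: hc
  assume "\<sigma> \<in> {\<sigma>. \<exists>p\<in>G. kpair \<sigma> p \<in> elts \<tau>}"
  then obtain p where "kpair \<sigma> p \<in> elts \<tau>" by blast
  from name_dom_trancl[OF this]
  show "((G, \<sigma>), (G, \<tau>)) \<in> inv_image ({(y, x). y \<in> elts x}\<^sup>+) snd"
    by (simp only: in_inv_image snd_conv)
qed

declare val.simps [simp del]

definition gen_ext :: "hc set \<Rightarrow> hc \<Rightarrow> hc set \<Rightarrow> hc set" where
  "gen_ext N P G = {val G \<tau> | \<tau>. \<tau> \<in> N \<and> is_name P \<tau>}"

text \<open>
  The forcing relation over the countable transitive model \<open>N\<close>, in its semantic form: \<open>p\<close> forces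
  a statement about the generic filter if it holds for every generic filter containing \<open>p\<close>.
\<close>

definition forced_by :: "hc set \<Rightarrow> hc \<Rightarrow> hc \<Rightarrow> hc \<Rightarrow> hc \<Rightarrow> (hc set \<Rightarrow> bool) \<Rightarrow> bool" where
  "forced_by N P le o1 p \<Phi> \<longleftrightarrow> (\<forall>G. generic_over N P le o1 G \<and> p \<in> G \<longrightarrow> \<Phi> G)"

section \<open>Definable classes of forcing notions\<close>

text \<open>
  \<open>in_class \<gamma> N P le o1\<close> says that the triple is a forcing notion belonging to \<open>\<Gamma>\<close> as computed
  in \<open>N\<close>, where \<open>\<gamma>\<close> is the defining formula. All free variables of \<open>\<gamma>\<close> are interpreted by the
  triple, so \<open>\<gamma>\<close> acts as a formula in one free variable, without parameters. Being a forcing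
  notion is absolute for transitive models, hence not relativized.
\<close>

definition in_class :: "fm \<Rightarrow> hc set \<Rightarrow> hc \<Rightarrow> hc \<Rightarrow> hc \<Rightarrow> bool" where
  "in_class \<gamma> N P le o1 \<longleftrightarrow>
    ktriple P le o1 \<in> N \<and> forcing_notion P le o1 \<and> sat N (\<lambda>_. ktriple P le o1) \<gamma>"

definition contains_trivial :: "fm \<Rightarrow> hc set \<Rightarrow> bool" where
  "contains_trivial \<gamma> N \<longleftrightarrow>
    in_class \<gamma> N (hset {hset {}}) (hset {kpair (hset {}) (hset {})}) (hset {})"

text \<open>
  The two-step iteration of \<open>(P, le, o1)\<close> with the triple of names \<open>(Q, leQ, oQ)\<close>, following Kunen:
  its conditions are the \<open>(p, \<tau>)\<close> with \<open>p \<in> P\<close>, \<open>\<tau> \<in> dom Q\<close> such that \<open>p\<close> forces \<open>\<tau> \<in> Q\<close>.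
\<close>

definition iter_conds :: "hc set \<Rightarrow> hc \<Rightarrow> hc \<Rightarrow> hc \<Rightarrow> hc \<Rightarrow> hc set" where
  "iter_conds N P le o1 Q =
    {kpair p \<tau> | p \<tau>. p \<in> elts P \<and> \<tau> \<in> name_dom Q \<and>
      forced_by N P le o1 p (\<lambda>G. val G \<tau> \<in> elts (val G Q))}"

definition iter_le :: "hc set \<Rightarrow> hc \<Rightarrow> hc \<Rightarrow> hc \<Rightarrow> hc \<Rightarrow> hc \<Rightarrow> hc set" where
  "iter_le N P le o1 Q leQ =
    {kpair (kpair p \<tau>) (kpair q \<sigma>) | p \<tau> q \<sigma>.
      kpair p \<tau> \<in> iter_conds N P le o1 Q \<and> kpair q \<sigma> \<in> iter_conds N P le o1 Q \<and>
      kpair p q \<in> elts le \<and>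
      forced_by N P le o1 p (\<lambda>G. kpair (val G \<tau>) (val G \<sigma>) \<in> elts (val G leQ))}"

definition closed_two_step :: "fm \<Rightarrow> hc set \<Rightarrow> bool" where
  "closed_two_step \<gamma> N \<longleftrightarrow>
    (\<forall>P le o1 Q leQ oQ.
      in_class \<gamma> N P le o1 \<and>
      Q \<in> N \<and> leQ \<in> N \<and> oQ \<in> N \<and> is_name P Q \<and> is_name P leQ \<and> is_name P oQ \<and>
      oQ \<in> name_dom Q \<and>
      forced_by N P le o1 o1
        (\<lambda>G. in_class \<gamma> (gen_ext N P G) (val G Q) (val G leQ) (val G oQ)) \<longrightarrow>
      in_class \<gamma> N (hset (iter_conds N P le o1 Q)) (hset (iter_le N P le o1 Q leQ)) (kpair o1 oQ))"

section \<open>The multiverse\<close>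

text \<open>\<open>extends \<gamma> N' N\<close> is the relation \<open>N' \<le> N\<close>.\<close>

definition extends :: "fm \<Rightarrow> hc set \<Rightarrow> hc set \<Rightarrow> bool" where
  "extends \<gamma> N' N \<longleftrightarrow>
    (\<exists>P le o1 G. in_class \<gamma> N P le o1 \<and> generic_over N P le o1 G \<and> N' = gen_ext N P G)"

definition multiverse :: "fm \<Rightarrow> hc set \<Rightarrow> hc set set" where
  "multiverse \<gamma> M = {N. extends \<gamma> N M}"

text \<open>
  The standing assumption on \<open>\<Gamma>\<close>, a property of the class defined by \<open>\<gamma>\<close>, is required of the
  interpretation of this class in each model of the multiverse.
\<close>

definition admissible_class :: "fm \<Rightarrow> hc set \<Rightarrow> bool" where
  "admissible_class \<gamma> M \<longleftrightarrow>
    (\<forall>N \<in> insert M (multiverse \<gamma> M). contains_trivial \<gamma> N \<and> closed_two_step \<gamma> N)"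

definition sigma_closed :: "fm \<Rightarrow> hc set \<Rightarrow> bool" where
  "sigma_closed \<gamma> M \<longleftrightarrow>
    (\<forall>S :: nat \<Rightarrow> hc set.
      (\<forall>i. S i \<in> multiverse \<gamma> M \<and> extends \<gamma> (S (Suc i)) (S i)) \<longrightarrow>
      (\<exists>N \<in> multiverse \<gamma> M. \<forall>i. extends \<gamma> N (S i)))"

text \<open>\<open>mforces \<gamma> M N e \<phi>\<close> is infinite multiverse forcing; the models range over the multiverse of \<open>M\<close>.\<close>

primrec mforces :: "fm \<Rightarrow> hc set \<Rightarrow> hc set \<Rightarrow> (nat \<Rightarrow> hc) \<Rightarrow> fm \<Rightarrow> bool" where
  "mforces \<gamma> M N e (Mem i j) \<longleftrightarrow> sat N e (Mem i j)"
| "mforces \<gamma> M N e (Equal i j) \<longleftrightarrow> sat N e (Equal i j)"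
| "mforces \<gamma> M N e (And \<phi> \<psi>) \<longleftrightarrow> mforces \<gamma> M N e \<phi> \<and> mforces \<gamma> M N e \<psi>"
| "mforces \<gamma> M N e (Or \<phi> \<psi>) \<longleftrightarrow> mforces \<gamma> M N e \<phi> \<or> mforces \<gamma> M N e \<psi>"
| "mforces \<gamma> M N e (Neg \<phi>) \<longleftrightarrow>
    \<not> (\<exists>Q \<in> multiverse \<gamma> M. extends \<gamma> Q N \<and> mforces \<gamma> M Q e \<phi>)"
| "mforces \<gamma> M N e (Exi \<phi>) \<longleftrightarrow> (\<exists>a\<in>N. mforces \<gamma> M N (case_nat a e) \<phi>)"

definition infinitely_generic :: "fm \<Rightarrow> hc set \<Rightarrow> hc set \<Rightarrow> bool" where
  "infinitely_generic \<gamma> M N \<longleftrightarrow>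
    (\<forall>\<phi> e. assignment_in N e \<longrightarrow> mforces \<gamma> M N e \<phi> \<or> mforces \<gamma> M N e (Neg \<phi>))"

end

theory Submission
  imports Defs
begin

text \<open>
  An infinitely generic \<open>N\<close> has no proper extension in the multiverse, so \<open>N' = N\<close>. Indeed, let
  \<open>N' = N[G]\<close> with \<open>G \<subseteq> P \<in> N\<close>, and let \<open>w \<in> N\<close> contain all subsets of \<open>P\<close> lying in \<open>N\<close>. If \<open>G \<notin> N\<close>,
  then \<open>N'\<close> forces \<open>\<exists>x. x \<subseteq> P \<and> x \<notin> w\<close> with the witness \<open>G\<close>, hence so does \<open>N\<close>, which contradicts the
  choice of \<open>w\<close>. Thus \<open>G \<in> N\<close> and \<open>N[G] = N\<close>. From the theory of forcing this needs the truth lemma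
  for atomic formulas only: it gives \<open>w\<close>, the evaluation of names inside \<open>N\<close>, and the reflexivity of the
  extension relation via the trivial forcing.
\<close>

section \<open>Hereditarily countable sets\<close>

text \<open>A model N of the multiverse is handled through M, where ZFC is available: a set that N
  should contain is exhibited as the value of some name, and the work lies in showing that this name
  belongs to M. Such names arise by recursion over transitive closures, so recursion has to be
  carried out inside M; the calculus of \<open>DF\<close> and \<open>TD\<close> reduces this to
  resolution with closure rules. N in turn carries a second forcing P with its own names in N. Check
  names for P, the canonical name of G and the evaluation of names for P are therefore described
  once more by names in M. The sentence tested on N is one for which multiverse forcing can be
  computed. Under its negations there are only bounded statements about fixed sets, which no
  extension changes; since extension is reflexive, forcing this sentence amounts to its truth. The
  parameter w lets an atomic formula express that x is new.\<close>

lemma countable_Collect_elts [simp]: "countable {z \<in> elts x. Q z}"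
  by (rule countable_subset[of _ "elts x"]) auto

abbreviation mem_rel :: "(hc \<times> hc) set" where
  "mem_rel \<equiv> {(y, x). y \<in> elts x}"

section \<open>Transitive closures and induction along them\<close>

text \<open>A countable union of countable sets, by \<in>-induction. This makes \<open>hset\<close>
  meaningful in the closures below.\<close>

lemma countable_mem_rtrancl [simp]: "countable {y. (y, x) \<in> mem_rel\<^sup>*}"
proof (induction x rule: hc_induct)
  case (1 x)
  have "{y. (y, x) \<in> mem_rel\<^sup>*} = insert x (\<Union>z\<in>elts x. {y. (y, z) \<in> mem_rel\<^sup>*})"
    by (auto elim: rtranclE intro: rtrancl_into_rtrancl)
  with 1 show ?case by simp
qed

lemma countable_mem_trancl [simp]: "countable {y. (y, x) \<in> mem_rel\<^sup>+}"
  by (rule countable_subset[OF _ countable_mem_rtrancl]) (auto intro: trancl_into_rtrancl)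

definition TC :: "hc \<Rightarrow> hc" where
  "TC x = hset {y. (y, x) \<in> mem_rel\<^sup>*}"

text \<open>The proper closure, without x itself. Written through \<open>TC\<close> so that its
  definability over M follows from that of \<open>TC\<close> by the closure rules;
  \<open>elts_PTC\<close> gives the usual description.\<close>

definition PTC :: "hc \<Rightarrow> hc" where
  "PTC x = hset (\<Union>y\<in>elts x. elts (TC y))"

lemma elts_TC: "elts (TC x) = {y. (y, x) \<in> mem_rel\<^sup>*}"
  by (simp add: TC_def)

lemma elts_PTC: "elts (PTC x) = {y. (y, x) \<in> mem_rel\<^sup>+}"
  by (auto simp: PTC_def elts_TC intro: rtrancl_into_trancl1 dest: tranclD2)

lemma TC_unfold: "TC x = hset (insert x (elts (PTC x)))"
  by (auto simp: hc_ext elts_TC elts_PTC rtrancl_eq_or_trancl)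

lemma TC_refl [simp]: "x \<in> elts (TC x)"
  by (simp add: elts_TC)

lemma TC_step: "y \<in> elts (TC x) \<Longrightarrow> z \<in> elts y \<Longrightarrow> z \<in> elts (TC x)"
  by (auto simp: elts_TC intro: converse_rtrancl_into_rtrancl)

lemma PTC_TC: "y \<in> elts (TC x) \<Longrightarrow> z \<in> elts (PTC y) \<Longrightarrow> z \<in> elts (TC x)"
  using rtrancl_trans[OF trancl_into_rtrancl] by (simp add: elts_TC elts_PTC)

lemma PTC_pair: "kpair \<rho> p \<in> elts \<sigma> \<Longrightarrow> \<rho> \<in> elts (PTC \<sigma>)"
  using name_dom_trancl by (simp add: elts_PTC)

lemma PTC_trans: "z \<in> elts (PTC y) \<Longrightarrow> y \<in> elts (PTC x) \<Longrightarrow> z \<in> elts (PTC x)"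
  by (simp add: elts_PTC)

text \<open>The form of induction suited to names: a subname lies three membership steps below its
  name, because Kuratowski pairs intervene.\<close>

lemma PTC_induct:
  assumes step: "\<And>x. (\<And>y. y \<in> elts (PTC x) \<Longrightarrow> P y) \<Longrightarrow> P x"
  shows "P x"
proof (induction x rule: wf_induct_rule[OF wf_trancl[OF wf_elts]])
  case (1 x)
  show ?case
  proof (rule step)
    fix y assume "y \<in> elts (PTC x)"
    then show "P y" using 1 by (simp only: elts_PTC mem_Collect_eq)
  qed
qed

section \<open>Projections, application and recursion\<close>

text \<open>Total, with the empty set as default on non-pairs. The default belongs to M, so the
  projections become definable operations on all of M.\<close>

definition kfst :: "hc \<Rightarrow> hc" where
  "kfst v = (if \<exists>a b. v = kpair a b then THE a. \<exists>b. v = kpair a b else hset {})"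

definition ksnd :: "hc \<Rightarrow> hc" where
  "ksnd v = (if \<exists>a b. v = kpair a b then THE b. \<exists>a. v = kpair a b else hset {})"

lemma kfst_kpair [simp]: "kfst (kpair a b) = a"
  by (auto simp: kfst_def)

lemma ksnd_kpair [simp]: "ksnd (kpair a b) = b"
  by (auto simp: ksnd_def)

text \<open>The union makes \<open>app\<close> total; on a function it returns the unique value.\<close>

definition app :: "hc \<Rightarrow> hc \<Rightarrow> hc" where
  "app f z = hset (\<Union>v\<in>{v \<in> elts f. kfst v = z}. elts (ksnd v))"

text \<open>The previous values are passed as a graph, that is as a set, so that one recursion step
  is an operation on sets of the model. The domain \<open>PTC x\<close> of this graph contains all
  subnames of a name x.\<close>

function hrec :: "(hc \<Rightarrow> hc \<Rightarrow> hc) \<Rightarrow> hc \<Rightarrow> hc" where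
  "hrec H x = H x (hset ((\<lambda>z. kpair z (hrec H z)) ` elts (PTC x)))"
  by auto
termination
proof (relation "inv_image (mem_rel\<^sup>+) snd")
  show "wf (inv_image (mem_rel\<^sup>+) (snd :: (hc \<Rightarrow> hc \<Rightarrow> hc) \<times> hc \<Rightarrow> hc))"
    by (intro wf_inv_image wf_trancl wf_elts)
qed (simp only: in_inv_image snd_conv elts_PTC mem_Collect_eq)

declare hrec.simps [simp del]

lemma app_graph: "z \<in> elts A \<Longrightarrow> app (hset ((\<lambda>z. kpair z (F z)) ` elts A)) z = F z"
proof -
  assume "z \<in> elts A"
  then have "{v \<in> (\<lambda>z. kpair z (F z)) ` elts A. kfst v = z} = {kpair z (F z)}" by auto
  then show ?thesis by (simp add: app_def)
qed

lemma elts_val: "elts (val G \<tau>) = {val G \<sigma> | \<sigma> p. p \<in> G \<and> kpair \<sigma> p \<in> elts \<tau>}"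
proof -
  have "{\<sigma>. \<exists>p\<in>G. kpair \<sigma> p \<in> elts \<tau>} \<subseteq> kfst ` elts \<tau>" by force
  then have "countable {\<sigma>. \<exists>p\<in>G. kpair \<sigma> p \<in> elts \<tau>}" by (rule countable_subset) simp
  then show ?thesis by (subst val.simps) auto
qed

section \<open>Definability over a countable transitive model\<close>

primrec ren :: "fm \<Rightarrow> (nat \<Rightarrow> nat) \<Rightarrow> fm" where
  "ren (Mem i j) f = Mem (f i) (f j)"
| "ren (Equal i j) f = Equal (f i) (f j)"
| "ren (And \<phi> \<psi>) f = And (ren \<phi> f) (ren \<psi> f)"
| "ren (Or \<phi> \<psi>) f = Or (ren \<phi> f) (ren \<psi> f)"
| "ren (Neg \<phi>) f = Neg (ren \<phi> f)"
| "ren (Exi \<phi>) f = Exi (ren \<phi> (case_nat 0 (\<lambda>n. Suc (f n))))"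

lemma sat_ren: "sat N e (ren \<phi> f) \<longleftrightarrow> sat N (\<lambda>n. e (f n)) \<phi>"
proof (induction \<phi> arbitrary: e f)
  case (Exi \<phi>)
  have "(\<lambda>n. case_nat a e (case_nat 0 (\<lambda>n. Suc (f n)) n)) = case_nat a (\<lambda>n. e (f n))" for a
    by (auto split: nat.split)
  with Exi show ?case by simp
qed auto

text \<open>The first k places of a formula read the arguments e, and the places from k on read the
  parameters d. Keeping k explicit leaves room to merge the parameters of several formulas.\<close>

definition mix :: "nat \<Rightarrow> (nat \<Rightarrow> hc) \<Rightarrow> (nat \<Rightarrow> hc) \<Rightarrow> nat \<Rightarrow> hc" where
  "mix k e d i = (if i < k then e i else d (i - k))"

locale ctm =
  fixes M :: "hc set"
  assumes ctm: "ctm_ZFC M"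
begin

lemma M_trans: "x \<in> M \<Longrightarrow> y \<in> elts x \<Longrightarrow> y \<in> M"
  using ctm by (auto simp: ctm_ZFC_def)

abbreviation asg :: "(nat \<Rightarrow> hc) \<Rightarrow> bool" where
  "asg \<equiv> assignment_in M"

lemma asg_case [simp]: "asg (case_nat a e) \<longleftrightarrow> a \<in> M \<and> asg e"
  unfolding assignment_in_def by (metis (no_types, lifting) nat.case nat.exhaust)

lemma asgD [simp]: "asg e \<Longrightarrow> e i \<in> M"
  by (simp add: assignment_in_def)

lemma asgI: "(\<And>i. e i \<in> M) \<Longrightarrow> asg e"
  by (simp add: assignment_in_def)

text \<open>
  In the closure rules for definable predicates (\<open>DF\<close>) and definable operations (\<open>TD\<close>), a premise with
  a bound variable has \<open>\<lambda>n. e (Suc n)\<close> as the old assignment and \<open>e 0\<close> as the new variable. Resolution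
  with these rules then performs the de Bruijn bookkeeping.
\<close>

definition DF :: "((nat \<Rightarrow> hc) \<Rightarrow> bool) \<Rightarrow> bool" where
  "DF Q \<longleftrightarrow> (\<exists>\<phi> k d. asg d \<and> (\<forall>e. asg e \<longrightarrow> (Q e \<longleftrightarrow> sat M (mix k e d) \<phi>)))"

definition TD :: "((nat \<Rightarrow> hc) \<Rightarrow> hc) \<Rightarrow> bool" where
  "TD t \<longleftrightarrow> (\<forall>e. asg e \<longrightarrow> t e \<in> M) \<and> DF (\<lambda>e. e 0 = t (\<lambda>n. e (Suc n)))"

lemma DF_cong: "(\<And>e. asg e \<Longrightarrow> Q e \<longleftrightarrow> Q' e) \<Longrightarrow> DF Q' \<Longrightarrow> DF Q"
  unfolding DF_def by (auto cong: conj_cong)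

lemma DF_ren:
  assumes "DF Q"
  shows "DF (\<lambda>e. Q (\<lambda>n. e (f n)))"
proof -
  from assms obtain \<phi> k d where d: "asg d" and Q: "\<And>e. asg e \<Longrightarrow> Q e \<longleftrightarrow> sat M (mix k e d) \<phi>"
    unfolding DF_def by blast
  \<comment> \<open>Only the finitely many argument places below k are renamed; k' exceeds all their
    images, so the parameters can start there.\<close>
  define k' where "k' = Suc (Max (insert 0 (f ` {..<k})))"
  have k': "f i < k'" if "i < k" for i
    using that unfolding k'_def by (auto simp: less_Suc_eq_le intro!: Max_ge)
  define g where "g i = (if i < k then f i else k' + (i - k))" for i
  have "(\<lambda>n. mix k' e d (g n)) = mix k (\<lambda>n. e (f n)) d" for e
    using k' by (auto simp: mix_def g_def fun_eq_iff)
  moreover have "asg (\<lambda>n. e (f n))" if "asg e" for e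
    using that by (simp add: assignment_in_def)
  ultimately show ?thesis
    unfolding DF_def using d Q
    by (intro exI[of _ "ren \<phi> g"] exI[of _ k'] exI[of _ d]) (simp add: sat_ren)
qed

lemma DF_neg: "DF Q \<Longrightarrow> DF (\<lambda>e. \<not> Q e)"
  unfolding DF_def by (metis sat.simps(5))

lemma DF_conj:
  assumes "DF Q" "DF R"
  shows "DF (\<lambda>e. Q e \<and> R e)"
proof -
  from assms(1) obtain \<phi> k d where d: "asg d" and Q: "\<And>e. asg e \<Longrightarrow> Q e \<longleftrightarrow> sat M (mix k e d) \<phi>"
    unfolding DF_def by blast
  from assms(2) obtain \<psi> l c where c: "asg c" and R: "\<And>e. asg e \<Longrightarrow> R e \<longleftrightarrow> sat M (mix l e c) \<psi>"
    unfolding DF_def by blast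
  \<comment> \<open>The two lists of parameters are interleaved behind k + l argument
    places.\<close>
  define b where "b i = (if even i then d (i div 2) else c (i div 2))" for i
  define f where "f i = (if i < k then i else k + l + 2 * (i - k))" for i
  define g where "g i = (if i < l then i else k + l + 2 * (i - l) + 1)" for i
  have "(\<lambda>n. mix (k + l) e b (f n)) = mix k e d" "(\<lambda>n. mix (k + l) e b (g n)) = mix l e c" for e
    by (auto simp: mix_def f_def g_def b_def fun_eq_iff)
  moreover have "asg b" using c d by (simp add: b_def assignment_in_def)
  ultimately show ?thesis
    unfolding DF_def using Q R
    by (intro exI[of _ "And (ren \<phi> f) (ren \<psi> g)"] exI[of _ "k + l"] exI[of _ b]) (simp add: sat_ren)
qed

lemma DF_ex:
  assumes "DF (\<lambda>e. Q (\<lambda>n. e (Suc n)) (e 0))"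
  shows "DF (\<lambda>e. \<exists>a\<in>M. Q e a)"
proof -
  from assms obtain \<phi> k d where d: "asg d"
    and Q: "\<And>e. asg e \<Longrightarrow> Q (\<lambda>n. e (Suc n)) (e 0) \<longleftrightarrow> sat M (mix k e d) \<phi>"
    unfolding DF_def by blast
  \<comment> \<open>The bound variable occupies one argument place. For k = 0 the truncated
    difference is again 0: all places are parameters, and \<open>f\<close> moves them past the
    binder.\<close>
  define k' where "k' = k - 1"
  define f where "f i = (if i < k then i else Suc (k' + (i - k)))" for i
  have *: "(\<lambda>n. case_nat a (mix k' e d) (f n)) = mix k (case_nat a e) d" for a e
    by (auto simp: mix_def f_def k'_def fun_eq_iff split: nat.split)
  have "Q e a \<longleftrightarrow> sat M (case_nat a (mix k' e d)) (ren \<phi> f)" if "asg e" "a \<in> M" for e a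
    using Q[of "case_nat a e"] that by (simp add: sat_ren *)
  then show ?thesis
    unfolding DF_def using d
    by (intro exI[of _ "Exi (ren \<phi> f)"] exI[of _ k'] exI[of _ d]) auto
qed

lemma DF_disj: "DF Q \<Longrightarrow> DF R \<Longrightarrow> DF (\<lambda>e. Q e \<or> R e)"
  by (rule DF_cong[where Q' = "\<lambda>e. \<not> (\<not> Q e \<and> \<not> R e)"]) (simp, intro DF_neg DF_conj)

lemma DF_imp: "DF Q \<Longrightarrow> DF R \<Longrightarrow> DF (\<lambda>e. Q e \<longrightarrow> R e)"
  by (rule DF_cong[where Q' = "\<lambda>e. \<not> Q e \<or> R e"]) (simp, intro DF_neg DF_disj)

lemma DF_iff: "DF Q \<Longrightarrow> DF R \<Longrightarrow> DF (\<lambda>e. Q e \<longleftrightarrow> R e)"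
  by (rule DF_cong[where Q' = "\<lambda>e. (Q e \<longrightarrow> R e) \<and> (R e \<longrightarrow> Q e)"])
    (blast, intro DF_imp DF_conj)

lemma DF_all: "DF (\<lambda>e. Q (\<lambda>n. e (Suc n)) (e 0)) \<Longrightarrow> DF (\<lambda>e. \<forall>a\<in>M. Q e a)"
  by (rule DF_cong[where Q' = "\<lambda>e. \<not> (\<exists>a\<in>M. \<not> Q e a)"]) (simp, intro DF_neg DF_ex)

lemma empty_M: "hset {} \<in> M"
proof -
  from ctm have "ax_infinity M" by (simp add: ctm_ZFC_def models_ZFC_def)
  then obtain z where "z \<in> M" "\<forall>w\<in>M. w \<notin> elts z"
    unfolding ax_infinity_def by blast
  then have "elts z = {}" using M_trans by blast
  with \<open>z \<in> M\<close> show ?thesis by (metis hset_elts)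
qed

lemma DF_var_mem: "DF (\<lambda>e. e i \<in> elts (e j))"
  unfolding DF_def
  by (intro exI[of _ "Mem i j"] exI[of _ "Suc (i + j)"] exI[of _ "\<lambda>_. hset {}"])
    (auto simp: mix_def assignment_in_def empty_M)

lemma DF_var_eq: "DF (\<lambda>e. e i = e j)"
  unfolding DF_def
  by (intro exI[of _ "Equal i j"] exI[of _ "Suc (i + j)"] exI[of _ "\<lambda>_. hset {}"])
    (auto simp: mix_def assignment_in_def empty_M)

text \<open>The axiom schemes expect the variables z and y in front of one assignment of parameters.
  To obtain it, the remaining arguments e are treated as parameters and merged with those of the
  formula.\<close>

lemma DF_assignment2:
  assumes "DF Q" "asg e"
  shows "\<exists>\<phi> e'. asg e' \<and> (\<forall>z\<in>M. \<forall>y\<in>M.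
    Q (case_nat z (case_nat y e)) \<longleftrightarrow> sat M (case_nat z (case_nat y e')) \<phi>)"
proof -
  from assms obtain \<phi> k d where d: "asg d" and Q: "\<And>e. asg e \<Longrightarrow> Q e \<longleftrightarrow> sat M (mix k e d) \<phi>"
    unfolding DF_def by blast
  define b where "b i = (if even i then e (i div 2) else d (i div 2))" for i
  \<comment> \<open>Places 0 and 1 stay with z and y. Behind them the even places hold e and the odd
    ones d.\<close>
  define f where "f i = (if i < k then if i < 2 then i else 2 + 2 * (i - 2) else 2 + (2 * (i - k) + 1))" for i
  have f: "case_nat z (case_nat y b) (f n) = mix k (case_nat z (case_nat y e)) d n" for z y n
  proof (cases "n < k")
    case True
    consider "n = 0" | "n = 1" | m where "n = Suc (Suc m)"
      by (metis One_nat_def not0_implies_Suc)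
    then show ?thesis
      using True by cases (simp_all add: f_def b_def mix_def)
  next
    case False
    then have "f n = Suc (Suc (2 * (n - k) + 1))" by (simp add: f_def)
    then show ?thesis using False by (simp add: mix_def b_def)
  qed
  have "asg b" using assms(2) d by (simp add: b_def assignment_in_def)
  moreover have "Q (case_nat z (case_nat y e)) \<longleftrightarrow> sat M (case_nat z (case_nat y b)) (ren \<phi> f)"
    if "z \<in> M" "y \<in> M" for z y
    using that assms(2) by (simp add: sat_ren f Q)
  ultimately show ?thesis by (intro exI[of _ "ren \<phi> f"] exI[of _ b]) simp
qed

lemma DF_assignment1:
  assumes "DF Q" "asg e"
  shows "\<exists>\<phi> e'. asg e' \<and> (\<forall>z\<in>M. Q (case_nat z e) \<longleftrightarrow> sat M (case_nat z e') \<phi>)"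
proof -
  define f where "f = case_nat 0 (\<lambda>n. Suc (Suc n))"
  have f: "(\<lambda>n. case_nat z (case_nat y e) (f n)) = case_nat z e" for z y
    by (auto simp: f_def fun_eq_iff split: nat.split)
  obtain \<phi> e' where e': "asg e'" and \<phi>: "\<And>z y. z \<in> M \<Longrightarrow> y \<in> M \<Longrightarrow>
      Q (\<lambda>n. case_nat z (case_nat y e) (f n)) \<longleftrightarrow> sat M (case_nat z (case_nat y e')) \<phi>"
    using DF_assignment2[OF DF_ren[OF assms(1), of f] assms(2)] by (elim exE conjE) simp
  have "Q (case_nat z e) \<longleftrightarrow> sat M (case_nat z (case_nat (hset {}) e')) \<phi>" if "z \<in> M" for z
    using \<phi>[OF that empty_M] by (simp only: f)
  then show ?thesis
    using empty_M e' by (intro exI[of _ \<phi>] exI[of _ "case_nat (hset {}) e'"]) simp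
qed

section \<open>Definable operations and substitution\<close>

lemma TD_closed: "TD t \<Longrightarrow> asg e \<Longrightarrow> t e \<in> M"
  by (simp add: TD_def)

lemma TD_graph: "TD t \<Longrightarrow> DF (\<lambda>e. e 0 = t (\<lambda>n. e (Suc n)))"
  by (simp add: TD_def)

text \<open>The way in which sets are shown to belong to M: a set built by the \<open>TD\<close>
  rules from constants of M is a definable operation without arguments.\<close>

lemma TD_mem_M: "TD (\<lambda>_. c) \<Longrightarrow> c \<in> M"
  using TD_closed[of _ "\<lambda>_. hset {}"] by (simp add: asgI empty_M)

lemma TD_ren:
  assumes "TD t"
  shows "TD (\<lambda>e. t (\<lambda>n. e (f n)))"
proof -
  have "DF (\<lambda>e. e 0 = t (\<lambda>n. e (Suc (f n))))"
    using DF_ren[OF TD_graph[OF assms], of "case_nat 0 (\<lambda>n. Suc (f n))"] by simp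
  then show ?thesis
    using assms by (simp add: TD_def assignment_in_def)
qed

lemma TD_var: "TD (\<lambda>e. e i)"
  by (simp add: TD_def DF_var_eq)

lemma TD_const: "c \<in> M \<Longrightarrow> TD (\<lambda>e. c)"
  unfolding TD_def DF_def
  by (auto intro!: exI[of _ "Equal 0 1"] exI[of _ 1] exI[of _ "\<lambda>_. c"] simp: mix_def asgI)

lemma DF_subst:
  assumes t: "TD t" and Q: "DF (\<lambda>e. Q (\<lambda>n. e (Suc n)) (e 0))"
  shows "DF (\<lambda>e. Q e (t e))"
proof (rule DF_cong)
  show "Q e (t e) \<longleftrightarrow> (\<exists>a\<in>M. a = t e \<and> Q e a)" if "asg e" for e
    using TD_closed[OF t that] by blast
  show "DF (\<lambda>e. \<exists>a\<in>M. a = t e \<and> Q e a)"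
    by (intro DF_ex DF_conj TD_graph t Q)
qed

lemma TD_subst:
  assumes t: "TD t" and u: "TD (\<lambda>e. u (\<lambda>n. e (Suc n)) (e 0))"
  shows "TD (\<lambda>e. u e (t e))"
proof -
  have "u e (t e) \<in> M" if "asg e" for e
    using TD_closed[OF u, of "case_nat (t e) e"] TD_closed[OF t] that by simp
  moreover have "DF (\<lambda>e. e 0 = u (\<lambda>n. e (Suc n)) (t (\<lambda>n. e (Suc n))))"
  proof (rule DF_subst[where t = "\<lambda>e. t (\<lambda>n. e (Suc n))"])
    show "TD (\<lambda>e. t (\<lambda>n. e (Suc n)))" by (rule TD_ren[OF t])
    show "DF (\<lambda>e. e (Suc 0) = u (\<lambda>n. e (Suc (Suc n))) (e 0))"
      using DF_ren[OF TD_graph[OF u], of "case_nat 1 (case_nat 0 (\<lambda>n. Suc (Suc n)))"] by simp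
  qed
  ultimately show ?thesis by (simp add: TD_def)
qed

lemma TD_fun1: "TD (\<lambda>e. F (e 0)) \<Longrightarrow> TD s \<Longrightarrow> TD (\<lambda>e. F (s e))"
  by (rule TD_subst[where u = "\<lambda>_ a. F a"])

lemma TD_fun2:
  assumes H: "TD (\<lambda>e. H (e 0) (e (Suc 0)))" and s: "TD s" and t: "TD t"
  shows "TD (\<lambda>e. H (s e) (t e))"
proof (rule TD_subst[where u = "\<lambda>e a. H a (t e)", OF s])
  show "TD (\<lambda>e. H (e 0) (t (\<lambda>n. e (Suc n))))"
  proof (rule TD_subst[where u = "\<lambda>e b. H (e 0) b", OF TD_ren[OF t]])
    show "TD (\<lambda>e. H (e (Suc 0)) (e 0))"
      using TD_ren[OF H, of "case_nat 1 (\<lambda>_. 0)"] by simp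
  qed
qed

lemma DF_mem:
  assumes s: "TD s" and t: "TD t"
  shows "DF (\<lambda>e. s e \<in> elts (t e))"
  by (rule DF_subst[OF s], rule DF_subst[where Q = "\<lambda>e b. e 0 \<in> elts b", OF TD_ren[OF t]])
    (rule DF_var_mem)

lemma DF_eq:
  assumes s: "TD s" and t: "TD t"
  shows "DF (\<lambda>e. s e = t e)"
  by (rule DF_subst[OF s], rule DF_subst[where Q = "\<lambda>e b. e 0 = b", OF TD_ren[OF t]])
    (rule DF_var_eq)

lemma DF_bex:
  assumes s: "TD s" and Q: "DF (\<lambda>e. Q (\<lambda>n. e (Suc n)) (e 0))"
  shows "DF (\<lambda>e. \<exists>a\<in>elts (s e). Q e a)"
proof (rule DF_cong)
  show "(\<exists>a\<in>elts (s e). Q e a) \<longleftrightarrow> (\<exists>a\<in>M. a \<in> elts (s e) \<and> Q e a)" if "asg e" for e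
    using M_trans[OF TD_closed[OF s that]] by blast
  show "DF (\<lambda>e. \<exists>a\<in>M. a \<in> elts (s e) \<and> Q e a)"
    by (intro DF_ex DF_conj DF_mem TD_var TD_ren[OF s] s Q)
qed

lemma DF_ball:
  assumes s: "TD s" and Q: "DF (\<lambda>e. Q (\<lambda>n. e (Suc n)) (e 0))"
  shows "DF (\<lambda>e. \<forall>a\<in>elts (s e). Q e a)"
  by (rule DF_cong[where Q' = "\<lambda>e. \<not> (\<exists>a\<in>elts (s e). \<not> Q e a)"])
    (simp, intro DF_neg DF_bex s Q)

lemma DF_subset:
  assumes s: "TD s" and t: "TD t"
  shows "DF (\<lambda>e. elts (s e) \<subseteq> elts (t e))"
  unfolding subset_eq by (intro DF_ball DF_mem TD_var TD_ren[OF t] s)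

lemmas DF_intros = DF_conj DF_disj DF_neg DF_imp DF_iff DF_ex DF_all DF_bex DF_ball
  DF_mem DF_eq DF_subset TD_var

lemma countable_M: "A \<subseteq> M \<Longrightarrow> countable A"
  using ctm countable_subset by (auto simp: ctm_ZFC_def)

lemma eq_hset_iff:
  assumes "u \<in> M" "A \<subseteq> M"
  shows "u = hset A \<longleftrightarrow> (\<forall>y\<in>M. y \<in> elts u \<longleftrightarrow> y \<in> A)"
proof -
  have "u = hset A \<longleftrightarrow> elts u = A"
    using countable_M[OF assms(2)] by (metis elts_hset hset_elts)
  then show ?thesis using M_trans[OF assms(1)] assms(2) by blast
qed

text \<open>M is transitive, so a set of M is determined by its elements in M, and the graph of the
  operation is expressed by comparing elements.\<close>

lemma TD_hset:
  assumes "\<And>e. asg e \<Longrightarrow> A e \<subseteq> M" "\<And>e. asg e \<Longrightarrow> hset (A e) \<in> M"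
    and "DF (\<lambda>e. e 0 \<in> A (\<lambda>n. e (Suc n)))"
  shows "TD (\<lambda>e. hset (A e))"
  unfolding TD_def
proof (intro conjI allI impI)
  show "DF (\<lambda>e. e 0 = hset (A (\<lambda>n. e (Suc n))))"
  proof (rule DF_cong)
    show "e 0 = hset (A (\<lambda>n. e (Suc n))) \<longleftrightarrow> (\<forall>y\<in>M. y \<in> elts (e 0) \<longleftrightarrow> y \<in> A (\<lambda>n. e (Suc n)))"
      if "asg e" for e
      using that by (intro eq_hset_iff assms(1)) (simp_all add: assignment_in_def)
    show "DF (\<lambda>e. \<forall>y\<in>M. y \<in> elts (e 0) \<longleftrightarrow> y \<in> A (\<lambda>n. e (Suc n)))"
      using DF_ren[OF assms(3), of "case_nat 0 (\<lambda>n. Suc (Suc n))"]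
      by (intro DF_intros) simp
  qed
qed (use assms(2) in blast)

section \<open>Set formation from the axioms of ZFC\<close>

lemma separation:
  assumes "DF (\<lambda>e. Q (\<lambda>n. e (Suc n)) (e 0))" "asg e" "x \<in> M"
  shows "hset {z \<in> elts x. Q e z} \<in> M"
proof -
  obtain \<phi> e' where e': "asg e'" and \<phi>: "\<And>z. z \<in> M \<Longrightarrow> Q e z \<longleftrightarrow> sat M (case_nat z e') \<phi>"
    using DF_assignment1[OF assms(1,2)] by auto
  have "ax_separation M" using ctm by (simp add: ctm_ZFC_def models_ZFC_def)
  from this[unfolded ax_separation_def, rule_format, OF e' assms(3), of \<phi>]
  obtain u where "u \<in> M" and u: "\<And>z. z \<in> M \<Longrightarrow> z \<in> elts u \<longleftrightarrow> z \<in> elts x \<and> Q e z"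
    using \<phi> by auto
  then have "u = hset {z \<in> elts x. Q e z}"
    using M_trans[OF assms(3)] by (subst eq_hset_iff) auto
  with \<open>u \<in> M\<close> show ?thesis by simp
qed

lemma replacement:
  assumes R: "DF (\<lambda>e. R (\<lambda>n. e (Suc (Suc n))) (e 0) (e (Suc 0)))" and "asg e" "x \<in> M"
    and ex1: "\<And>z. z \<in> elts x \<Longrightarrow> \<exists>!y. y \<in> M \<and> R e z y"
  shows "hset {y \<in> M. \<exists>z\<in>elts x. R e z y} \<in> M"
proof -
  obtain \<phi> e' where e': "asg e'"
    and \<phi>: "\<And>z y. z \<in> M \<Longrightarrow> y \<in> M \<Longrightarrow> R e z y \<longleftrightarrow> sat M (case_nat z (case_nat y e')) \<phi>"
    using DF_assignment2[OF assms(1,2)] by auto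
  have "\<exists>!y. y \<in> M \<and> sat M (case_nat z (case_nat y e')) \<phi>" if "z \<in> M" "z \<in> elts x" for z
  proof -
    have "(y \<in> M \<and> sat M (case_nat z (case_nat y e')) \<phi>) \<longleftrightarrow> (y \<in> M \<and> R e z y)" for y
      using \<phi>[OF that(1)] by auto
    then show ?thesis using ex1[OF that(2)] by presburger
  qed
  moreover have "ax_replacement M" using ctm by (simp add: ctm_ZFC_def models_ZFC_def)
  note this[unfolded ax_replacement_def, rule_format, OF e' assms(3), of \<phi>]
  ultimately obtain u where "u \<in> M"
    and u: "\<And>z. z \<in> M \<Longrightarrow> z \<in> elts x \<Longrightarrow>
      \<exists>y\<in>M. y \<in> elts u \<and> sat M (case_nat z (case_nat y e')) \<phi>"
    by auto
  \<comment> \<open>The axiom yields only a set u meeting the values at each z. Uniqueness puts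
    every value into u, and separation removes the other elements.\<close>
  have "{y \<in> M. \<exists>z\<in>elts x. R e z y} = {y \<in> elts u. \<exists>z\<in>elts x. R e z y}"
  proof (intro equalityI subsetI)
    fix y assume "y \<in> {y \<in> M. \<exists>z\<in>elts x. R e z y}"
    then obtain z where z: "z \<in> elts x" "R e z y" "y \<in> M" by blast
    have "z \<in> M" using M_trans[OF assms(3) z(1)] .
    then obtain y' where y': "y' \<in> M" "y' \<in> elts u" "R e z y'"
      using u[OF _ z(1)] \<phi> by auto
    then have "y' = y" using ex1[OF z(1)] z by blast
    then show "y \<in> {y \<in> elts u. \<exists>z\<in>elts x. R e z y}" using y' z by blast
  qed (use M_trans[OF \<open>u \<in> M\<close>] in blast)
  moreover have "DF (\<lambda>e. \<exists>z\<in>elts x. R (\<lambda>n. e (Suc n)) z (e 0))"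
    by (intro DF_bex TD_const assms(3) R)
  ultimately show ?thesis
    using separation[OF _ assms(2) \<open>u \<in> M\<close>, where Q = "\<lambda>e y. \<exists>z\<in>elts x. R e z y"] by simp
qed

lemma TD_sep:
  assumes s: "TD s" and Q: "DF (\<lambda>e. Q (\<lambda>n. e (Suc n)) (e 0))"
  shows "TD (\<lambda>e. hset {z \<in> elts (s e). Q e z})"
proof (rule TD_hset)
  show "{z \<in> elts (s e). Q e z} \<subseteq> M" if "asg e" for e
    using M_trans[OF TD_closed[OF s that]] by blast
  show "DF (\<lambda>e. e 0 \<in> {z \<in> elts (s (\<lambda>n. e (Suc n))). Q (\<lambda>n. e (Suc n)) z})"
    unfolding mem_Collect_eq by (intro DF_intros TD_ren[OF s] s Q)
qed (intro separation TD_closed s Q)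

lemma TD_image:
  assumes s: "TD s" and t: "TD (\<lambda>e. t (\<lambda>n. e (Suc n)) (e 0))"
  shows "TD (\<lambda>e. hset (t e ` elts (s e)))"
proof (rule TD_hset)
  have t_M: "t e z \<in> M" if "asg e" "z \<in> M" for e z
    using TD_closed[OF t, of "case_nat z e"] that by simp
  show sub: "t e ` elts (s e) \<subseteq> M" if "asg e" for e
    using t_M[OF that] M_trans[OF TD_closed[OF s that]] by blast
  show "DF (\<lambda>e. e 0 \<in> t (\<lambda>n. e (Suc n)) ` elts (s (\<lambda>n. e (Suc n))))"
    unfolding image_iff
  proof (intro DF_intros TD_ren[OF s] s)
    show "TD (\<lambda>e. t (\<lambda>n. e (Suc (Suc n))) (e 0))"
      using TD_ren[OF t, of "case_nat 0 (\<lambda>n. Suc (Suc n))"] by simp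
  qed
  show "hset (t e ` elts (s e)) \<in> M" if e: "asg e" for e
  proof -
    have "hset {y \<in> M. \<exists>z\<in>elts (s e). y = t e z} \<in> M"
    proof (rule replacement[OF _ e TD_closed[OF s e]])
      show "DF (\<lambda>e. e (Suc 0) = t (\<lambda>n. e (Suc (Suc n))) (e 0))"
        using DF_eq[OF TD_var TD_ren[OF t, of "case_nat 0 (\<lambda>n. Suc (Suc n))"]] by simp
    qed (use sub[OF e] in blast)
    moreover have "{y \<in> M. \<exists>z\<in>elts (s e). y = t e z} = t e ` elts (s e)"
      using sub[OF e] by blast
    ultimately show ?thesis by simp
  qed
qed

lemma TD_Union:
  assumes s: "TD s"
  shows "TD (\<lambda>e. hset (\<Union>z\<in>elts (s e). elts z))"
proof (rule TD_hset)
  show sub: "(\<Union>z\<in>elts (s e). elts z) \<subseteq> M" if "asg e" for e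
    using M_trans TD_closed[OF s that] by blast
  show "DF (\<lambda>e. e 0 \<in> (\<Union>z\<in>elts (s (\<lambda>n. e (Suc n))). elts z))"
    unfolding UN_iff by (intro DF_intros TD_ren[OF s] s)
  show "hset (\<Union>z\<in>elts (s e). elts z) \<in> M" if e: "asg e" for e
  proof -
    have "ax_union M" using ctm by (simp add: ctm_ZFC_def models_ZFC_def)
    then obtain u where u: "u \<in> M"
      "\<forall>z\<in>M. z \<in> elts u \<longleftrightarrow> (\<exists>y\<in>M. y \<in> elts (s e) \<and> z \<in> elts y)"
      using TD_closed[OF s e] unfolding ax_union_def by blast
    then have "u = hset (\<Union>z\<in>elts (s e). elts z)"
      using M_trans[OF TD_closed[OF s e]] by (subst eq_hset_iff[OF _ sub[OF e]]) auto
    with u show ?thesis by simp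
  qed
qed

lemma TD_upair:
  assumes s: "TD s" and t: "TD t"
  shows "TD (\<lambda>e. hset {s e, t e})"
proof (rule TD_hset)
  show sub: "{s e, t e} \<subseteq> M" if "asg e" for e
    using TD_closed[OF s that] TD_closed[OF t that] by simp
  show "DF (\<lambda>e. e 0 \<in> {s (\<lambda>n. e (Suc n)), t (\<lambda>n. e (Suc n))})"
    unfolding insert_iff empty_iff simp_thms by (intro DF_intros TD_ren[OF s] TD_ren[OF t])
  show "hset {s e, t e} \<in> M" if e: "asg e" for e
  proof -
    have "ax_pairing M" using ctm by (simp add: ctm_ZFC_def models_ZFC_def)
    then obtain u where u: "u \<in> M" "\<forall>z\<in>M. z \<in> elts u \<longleftrightarrow> z = s e \<or> z = t e"
      using sub[OF e] unfolding ax_pairing_def by blast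
    then have "u = hset {s e, t e}" by (subst eq_hset_iff[OF _ sub[OF e]]) auto
    with u show ?thesis by simp
  qed
qed

lemma TD_Pow:
  assumes s: "TD s"
  shows "TD (\<lambda>e. hset {z \<in> M. elts z \<subseteq> elts (s e)})"
proof (rule TD_hset)
  show "DF (\<lambda>e. e 0 \<in> {z \<in> M. elts z \<subseteq> elts (s (\<lambda>n. e (Suc n)))})"
    by (rule DF_cong[where Q' = "\<lambda>e. elts (e 0) \<subseteq> elts (s (\<lambda>n. e (Suc n)))"])
      (simp, intro DF_intros TD_ren[OF s] s)
  show "hset {z \<in> M. elts z \<subseteq> elts (s e)} \<in> M" if e: "asg e" for e
  proof -
    have "ax_power_set M" using ctm by (simp add: ctm_ZFC_def models_ZFC_def)
    then obtain u where u: "u \<in> M"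
      "\<forall>z\<in>M. z \<in> elts u \<longleftrightarrow> (\<forall>w\<in>M. w \<in> elts z \<longrightarrow> w \<in> elts (s e))"
      using TD_closed[OF s e] unfolding ax_power_set_def by blast
    have "elts z \<subseteq> elts (s e) \<longleftrightarrow> (\<forall>w\<in>M. w \<in> elts z \<longrightarrow> w \<in> elts (s e))" if "z \<in> M" for z
      using M_trans[OF that] by blast
    with u have "u = hset {z \<in> M. elts z \<subseteq> elts (s e)}"
      by (subst eq_hset_iff) simp_all
    with u show ?thesis by simp
  qed
qed auto

lemma TD_singleton: "TD s \<Longrightarrow> TD (\<lambda>e. hset {s e})"
  using TD_upair[of s s] by simp

lemma TD_kpair: "TD s \<Longrightarrow> TD t \<Longrightarrow> TD (\<lambda>e. kpair (s e) (t e))"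
  unfolding kpair_def by (intro TD_upair TD_singleton)

lemma TD_UN:
  assumes "TD s" "TD (\<lambda>e. t (\<lambda>n. e (Suc n)) (e 0))"
  shows "TD (\<lambda>e. hset (\<Union>z\<in>elts (s e). elts (t e z)))"
  using TD_Union[OF TD_image[where t = t, OF assms]] by simp

lemma TD_Un:
  assumes "TD s" "TD t"
  shows "TD (\<lambda>e. hset (elts (s e) \<union> elts (t e)))"
  using TD_Union[OF TD_upair[OF assms]] by simp

lemma TD_insert:
  assumes "TD s" "TD t"
  shows "TD (\<lambda>e. hset (insert (s e) (elts (t e))))"
  using TD_Un[OF TD_singleton[OF assms(1)] assms(2)] by simp

lemma kpair_M: "kpair a b \<in> M \<longleftrightarrow> a \<in> M \<and> b \<in> M"
proof
  assume "kpair a b \<in> M"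
  moreover have "hset {a, b} \<in> elts (kpair a b)" by (simp add: kpair_def)
  ultimately have "hset {a, b} \<in> M" by (rule M_trans)
  then have "elts (hset {a, b}) \<subseteq> M" using M_trans by blast
  then show "a \<in> M \<and> b \<in> M" by simp
next
  assume "a \<in> M \<and> b \<in> M"
  then show "kpair a b \<in> M" by (intro TD_mem_M[OF TD_kpair] TD_const) auto
qed

lemma TD_kfst: "TD s \<Longrightarrow> TD (\<lambda>e. kfst (s e))"
proof (rule TD_fun1[where F = kfst])
  show "TD (\<lambda>e. kfst (e 0))"
    unfolding TD_def
  proof (intro conjI allI impI)
    fix e :: "nat \<Rightarrow> hc" assume "asg e"
    then have "e 0 \<in> M" by simp
    then show "kfst (e 0) \<in> M"
      by (cases "\<exists>a b. e 0 = kpair a b") (auto simp: kpair_M, auto simp: kfst_def empty_M)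
  next
    have "DF (\<lambda>e. (\<exists>b\<in>M. e (Suc 0) = kpair (e 0) b) \<or>
      (\<not> (\<exists>a\<in>M. \<exists>b\<in>M. e (Suc 0) = kpair a b)) \<and> e 0 = hset {})"
      by (intro DF_intros TD_kpair TD_const empty_M)
    then show "DF (\<lambda>e. e 0 = kfst (e (Suc 0)))"
    proof (rule DF_cong[rotated])
      fix e :: "nat \<Rightarrow> hc" assume "asg e"
      then have "e (Suc 0) \<in> M" by simp
      then show "e 0 = kfst (e (Suc 0)) \<longleftrightarrow> (\<exists>b\<in>M. e (Suc 0) = kpair (e 0) b) \<or>
          (\<not> (\<exists>a\<in>M. \<exists>b\<in>M. e (Suc 0) = kpair a b)) \<and> e 0 = hset {}"
        by (cases "\<exists>a b. e (Suc 0) = kpair a b") (auto simp: kpair_M, auto simp: kfst_def)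
    qed
  qed
qed

lemma TD_ksnd: "TD s \<Longrightarrow> TD (\<lambda>e. ksnd (s e))"
proof (rule TD_fun1[where F = ksnd])
  show "TD (\<lambda>e. ksnd (e 0))"
    unfolding TD_def
  proof (intro conjI allI impI)
    fix e :: "nat \<Rightarrow> hc" assume "asg e"
    then have "e 0 \<in> M" by simp
    then show "ksnd (e 0) \<in> M"
      by (cases "\<exists>a b. e 0 = kpair a b") (auto simp: kpair_M, auto simp: ksnd_def empty_M)
  next
    have "DF (\<lambda>e. (\<exists>a\<in>M. e (Suc 0) = kpair a (e 0)) \<or>
      (\<not> (\<exists>a\<in>M. \<exists>b\<in>M. e (Suc 0) = kpair a b)) \<and> e 0 = hset {})"
      by (intro DF_intros TD_kpair TD_const empty_M)
    then show "DF (\<lambda>e. e 0 = ksnd (e (Suc 0)))"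
    proof (rule DF_cong[rotated])
      fix e :: "nat \<Rightarrow> hc" assume "asg e"
      then have "e (Suc 0) \<in> M" by simp
      then show "e 0 = ksnd (e (Suc 0)) \<longleftrightarrow> (\<exists>a\<in>M. e (Suc 0) = kpair a (e 0)) \<or>
          (\<not> (\<exists>a\<in>M. \<exists>b\<in>M. e (Suc 0) = kpair a b)) \<and> e 0 = hset {}"
        by (cases "\<exists>a b. e (Suc 0) = kpair a b") (auto simp: kpair_M, auto simp: ksnd_def)
    qed
  qed
qed

lemma TD_app: "TD s \<Longrightarrow> TD t \<Longrightarrow> TD (\<lambda>e. app (s e) (t e))"
proof -
  assume s: "TD s" and t: "TD t"
  have "TD (\<lambda>e. hset (\<Union>v\<in>elts (hset {v \<in> elts (s e). kfst v = t e}). elts (ksnd v)))"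
    by (intro TD_UN TD_sep TD_ksnd DF_intros TD_kfst TD_ren[OF s] TD_ren[OF t])
  then show ?thesis by (simp add: app_def)
qed

section \<open>Recursion inside the model\<close>

text \<open>The values of F must be seen to lie in M before F can count as definable. Only R is
  definable at the outset, and it describes F wherever the value is in M; by \<in>-induction this
  holds at the elements of x, so replacement for R collects the values there.\<close>

lemma TD_by_mem_induct:
  assumes R: "DF (\<lambda>e. R (e 0) (e (Suc 0)))"
    and R_iff: "\<And>x y. x \<in> M \<Longrightarrow> y \<in> M \<Longrightarrow> F x \<in> M \<Longrightarrow> R x y \<longleftrightarrow> y = F x"
    and step: "\<And>x. x \<in> M \<Longrightarrow> hset (F ` elts x) \<in> M \<Longrightarrow> F x \<in> M"
  shows "TD (\<lambda>e. F (e 0))"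
proof -
  have closed: "x \<in> M \<longrightarrow> F x \<in> M" for x
  proof (induction x rule: hc_induct)
    case (1 x)
    show ?case
    proof
      assume x: "x \<in> M"
      have F_M: "F z \<in> M" if "z \<in> elts x" for z
        using 1[OF that] M_trans[OF x that] by blast
      have R_F: "R z y \<longleftrightarrow> y = F z" if "z \<in> elts x" "y \<in> M" for z y
        using R_iff M_trans[OF x that(1)] that(2) F_M[OF that(1)] by blast
      have "hset {y \<in> M. \<exists>z\<in>elts x. R z y} \<in> M"
        by (rule replacement[where e = "\<lambda>_. hset {}"])
          (use R R_F F_M x in \<open>auto simp: asgI empty_M\<close>)
      moreover have "{y \<in> M. \<exists>z\<in>elts x. R z y} = F ` elts x"
        using R_F F_M by auto
      ultimately show "F x \<in> M" using step[OF x] by simp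
    qed
  qed
  have "DF (\<lambda>e. R (e (Suc 0)) (e 0))"
    using DF_ren[OF R, of "case_nat 1 (\<lambda>_. 0)"] by simp
  then have "DF (\<lambda>e. e 0 = F (e (Suc 0)))"
    by (rule DF_cong[rotated]) (simp add: R_iff closed)
  then show ?thesis using closed by (simp add: TD_def)
qed

lemma TC_minimal:
  assumes "x \<in> elts s" "\<And>a. a \<in> elts s \<Longrightarrow> elts a \<subseteq> elts s"
  shows "elts (TC x) \<subseteq> elts s"
proof
  fix y assume "y \<in> elts (TC x)"
  then have "(y, x) \<in> mem_rel\<^sup>*" by (simp add: elts_TC)
  then show "y \<in> elts s"
    by (induction rule: converse_rtrancl_induct) (use assms in auto)
qed

lemma TD_TC: "TD s \<Longrightarrow> TD (\<lambda>e. TC (s e))"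
proof (rule TD_fun1[where F = TC])
  let ?T = "\<lambda>x t. x \<in> elts t \<and> (\<forall>a\<in>elts t. elts a \<subseteq> elts t)"
  \<comment> \<open>Minimality is tested against transitive sets of M only, which suffices as soon
    as \<open>TC x\<close> is itself in M.\<close>
  let ?R = "\<lambda>x t. ?T x t \<and> (\<forall>s\<in>M. ?T x s \<longrightarrow> elts t \<subseteq> elts s)"
  have T: "?T x (TC x)" for x
    using TC_step by auto
  show "TD (\<lambda>e. TC (e 0))"
  proof (rule TD_by_mem_induct[where R = ?R])
    show "DF (\<lambda>e. ?R (e 0) (e (Suc 0)))"
      by (intro DF_intros)
    show iff: "?R x y \<longleftrightarrow> y = TC x" if "TC x \<in> M" for x y
    proof
      assume R: "?R x y"
      then have "elts y \<subseteq> elts (TC x)" using that T by blast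
      moreover have "elts (TC x) \<subseteq> elts y" using TC_minimal[of x y] R by blast
      ultimately show "y = TC x" by (simp add: hc_ext)
    next
      assume "y = TC x"
      then show "?R x y" using T TC_minimal by blast
    qed
    show "TC x \<in> M" if x: "x \<in> M" and im: "hset (TC ` elts x) \<in> M" for x
    proof -
      have "TC x = hset (insert x (elts (hset (\<Union>z\<in>elts (hset (TC ` elts x)). elts z))))"
        by (simp add: TC_unfold[of x] PTC_def)
      then show ?thesis
        using TD_mem_M[OF TD_insert[OF TD_const[OF x] TD_Union[OF TD_const[OF im]]]] by simp
    qed
  qed
qed

lemma TD_PTC: "TD s \<Longrightarrow> TD (\<lambda>e. PTC (s e))"
  unfolding PTC_def by (intro TD_UN TD_TC TD_var)

lemmas TD_intros = TD_var TD_kpair TD_kfst TD_ksnd TD_app TD_TC TD_PTC TD_singleton TD_upair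
  TD_sep TD_image TD_UN TD_Un TD_insert TD_Pow

text \<open>The recursion theorem in M. The graph on \<open>TC x\<close> is the only u that is
  reproduced when each value is recomputed from the restriction of u to the proper closure; this
  fixed point property \<open>R\<close> is definable, and uniqueness is an induction along
  \<open>PTC\<close>.\<close>

lemma TD_hrec:
  assumes H: "TD (\<lambda>e. H (e 0) (e (Suc 0)))" and s: "TD s"
  shows "TD (\<lambda>e. hrec H (s e))"
proof (rule TD_fun1[OF _ s])
  let ?F = "hrec H"
  define g where "g x = hset ((\<lambda>z. kpair z (?F z)) ` elts (TC x))" for x
  define rst where "rst u z = hset {v \<in> elts u. kfst v \<in> elts (PTC z)}" for u z
  define R where "R x u \<longleftrightarrow> u = hset ((\<lambda>z. kpair z (H z (rst u z))) ` elts (TC x))" for x u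
  have rst_M: "TD (\<lambda>e. rst (s e) (t e))" if "TD s" "TD t" for s t
    unfolding rst_def by (intro TD_intros DF_intros TD_ren[OF that(2)] that)
  have rst_g: "rst (g x) z = hset ((\<lambda>z. kpair z (?F z)) ` elts (PTC z))" if "z \<in> elts (TC x)" for x z
  proof -
    have "{v \<in> elts (g x). kfst v \<in> elts (PTC z)} = (\<lambda>z. kpair z (?F z)) ` elts (PTC z)"
      using PTC_TC[OF that] by (auto simp: g_def)
    then show ?thesis by (simp add: rst_def)
  qed
  have F: "?F z = H z (rst (g x) z)" if "z \<in> elts (TC x)" for x z
    by (subst hrec.simps) (simp add: rst_g[OF that])
  have R_g: "R x (g x)" for x
    unfolding R_def by (subst g_def) (simp add: F cong: image_cong)
  have R_unique: "u = g x" if "R x u" for x u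
  proof -
    have elts_u: "elts u = (\<lambda>z. kpair z (H z (rst u z))) ` elts (TC x)"
      using that unfolding R_def by (metis countable_elts countable_image elts_hset)
    have "z \<in> elts (TC x) \<longrightarrow> H z (rst u z) = ?F z" for z
    proof (induction z rule: PTC_induct)
      case (1 z)
      show ?case
      proof
        assume z: "z \<in> elts (TC x)"
        have "{v \<in> elts u. kfst v \<in> elts (PTC z)} = (\<lambda>a. kpair a (?F a)) ` elts (PTC z)"
          using 1 PTC_TC[OF z] unfolding elts_u by force
        then show "H z (rst u z) = ?F z"
          by (subst hrec.simps) (simp add: rst_def)
      qed
    qed
    then show ?thesis
      using elts_u by (simp add: hc_ext[of u] g_def cong: image_cong)
  qed
  have R_iff: "R x u \<longleftrightarrow> u = g x" for x u
    using R_g R_unique by blast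
  have g: "TD (\<lambda>e. g (e 0))"
  proof (rule TD_by_mem_induct[where R = R])
    show "DF (\<lambda>e. R (e 0) (e (Suc 0)))"
      unfolding R_def by (intro TD_intros DF_intros TD_fun2[OF H] rst_M)
    show "g x \<in> M" if x: "x \<in> M" and im: "hset (g ` elts x) \<in> M" for x
    proof -
      \<comment> \<open>The graphs at the elements of x unite to the graph on \<open>PTC x\<close>;
        a single further pair completes it to \<open>TC x\<close>.\<close>
      define f where "f = hset (\<Union>z\<in>elts (hset (g ` elts x)). elts z)"
      have f_M: "f \<in> M"
        unfolding f_def by (intro TD_mem_M[OF TD_Union] TD_const im)
      have f: "f = hset ((\<lambda>z. kpair z (?F z)) ` elts (PTC x))"
        by (simp add: f_def g_def PTC_def image_UN)
      have "g x = hset (insert (kpair x (H x f)) (elts f))"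
        unfolding g_def f by (simp add: TC_unfold[of x] hrec.simps[of H x])
      moreover have "hset (insert (kpair x (H x f)) (elts f)) \<in> M"
        by (intro TD_mem_M[OF TD_insert] TD_kpair TD_fun2[OF H] TD_const x f_M)
      ultimately show ?thesis by simp
    qed
  qed (simp_all add: R_iff)
  have "?F x = H x (rst (g x) x)" for x
    by (rule F) simp
  moreover have "TD (\<lambda>e. H (e 0) (rst (g (e 0)) (e 0)))"
    by (intro TD_fun2[OF H] rst_M g TD_var)
  ultimately show "TD (\<lambda>e. ?F (e 0))" by simp
qed

end

section \<open>Forcing atomic formulas\<close>

definition prd :: "hc \<Rightarrow> hc \<Rightarrow> hc" where
  "prd A B = hset (\<Union>a\<in>elts A. elts (hset ((\<lambda>b. kpair a b) ` elts B)))"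

lemma elts_prd: "elts (prd A B) = {kpair a b | a b. a \<in> elts A \<and> b \<in> elts B}"
  by (auto simp: prd_def)

lemma kpair_prd [simp]: "kpair a b \<in> elts (prd A B) \<longleftrightarrow> a \<in> elts A \<and> b \<in> elts B"
  by (auto simp: elts_prd)

lemma (in ctm) TD_prd: "TD s \<Longrightarrow> TD t \<Longrightarrow> TD (\<lambda>e. prd (s e) (t e))"
  by (rule TD_fun2[where H = prd]) (unfold prd_def, intro TD_intros)

locale generic_extension = ctm +
  fixes P le o1 :: hc and G :: "hc set"
  assumes poset_M: "ktriple P le o1 \<in> M"
    and poset: "forcing_notion P le o1"
    and generic: "generic_over M P le o1 G"
begin

abbreviation leq :: "hc \<Rightarrow> hc \<Rightarrow> bool" where
  "leq p q \<equiv> kpair p q \<in> elts le"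

lemma P_M: "P \<in> M" and le_M: "le \<in> M" and o1_M: "o1 \<in> M"
  using poset_M by (simp_all add: ktriple_def kpair_M)

lemma leq_P:
  assumes "leq p q"
  shows "p \<in> elts P \<and> q \<in> elts P"
proof -
  have "\<exists>a\<in>elts P. \<exists>b\<in>elts P. kpair p q = kpair a b"
    using poset assms unfolding forcing_notion_def by blast
  then show ?thesis by simp
qed

lemma leq_refl: "p \<in> elts P \<Longrightarrow> leq p p"
  using poset unfolding forcing_notion_def by blast

lemma leq_trans: "leq p q \<Longrightarrow> leq q r \<Longrightarrow> leq p r"
  using poset unfolding forcing_notion_def by blast

lemma filter_G: "is_filter P le o1 G"
  using generic by (simp add: generic_over_def)

lemma G_P: "p \<in> G \<Longrightarrow> p \<in> elts P" and o1_G: "o1 \<in> G"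
  using filter_G unfolding is_filter_def by blast+

lemma G_up: "p \<in> G \<Longrightarrow> leq p q \<Longrightarrow> q \<in> G"
  using filter_G leq_P[of p q] unfolding is_filter_def by blast

lemma G_common: "p \<in> G \<Longrightarrow> q \<in> G \<Longrightarrow> \<exists>r\<in>G. leq r p \<and> leq r q"
  using filter_G unfolding is_filter_def by blast

text \<open>Genericity below p. Adding the conditions incompatible with p makes the set dense in all
  of P, and definability of Q puts it into M; an element of G is compatible with p, so it is of the
  first kind.\<close>

lemma generic_below:
  assumes Q: "DF (\<lambda>e. Q (e 0))" and p: "p \<in> G"
    and dense: "\<And>q. leq q p \<Longrightarrow> \<exists>r. leq r q \<and> Q r"
  shows "\<exists>q\<in>G. Q q"
proof -
  define D where "D = hset {q \<in> elts P. Q q \<or> \<not> (\<exists>r\<in>elts P. leq r q \<and> leq r p)}"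
  have "p \<in> M" using M_trans[OF P_M] G_P[OF p] by blast
  have "D \<in> M"
    unfolding D_def
    by (intro TD_mem_M[OF TD_sep] DF_disj[OF Q] DF_intros TD_kpair TD_const P_M le_M \<open>p \<in> M\<close>)
  moreover have "dense_in P le D"
    unfolding dense_in_def
  proof (intro conjI ballI)
    fix q assume q: "q \<in> elts P"
    show "\<exists>d\<in>elts D. leq d q"
    proof (cases "\<exists>r\<in>elts P. leq r q \<and> leq r p")
      case True
      then obtain r where r: "leq r q" "leq r p" by blast
      from dense[OF r(2)] obtain d where "leq d r" "Q d" by blast
      then show ?thesis
        using leq_P[of d r] leq_trans[OF _ r(1), of d] by (auto simp: D_def)
    next
      case False
      then have "q \<in> elts D" using q by (simp add: D_def)
      then show ?thesis using leq_refl[OF q] by blast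
    qed
  qed (auto simp: D_def)
  ultimately obtain q where q: "q \<in> G" "q \<in> elts D"
    using generic by (auto simp: generic_over_def)
  moreover obtain r where "r \<in> G" "leq r q" "leq r p"
    using G_common[OF q(1) p] by blast
  ultimately show ?thesis
    using G_P by (auto simp: D_def)
qed

text \<open>
  \<open>eqrel T p \<sigma> \<tau>\<close>: \<open>p\<close> forces \<open>\<sigma> = \<tau>\<close>. The relation is computed by recursion on \<open>\<sigma>\<close>, simultaneously
  for all \<open>\<tau>\<close> in the set \<open>T\<close>, which has to be closed under subnames. Arbitrary sets
  are used as names: members which are not pairs with second component in \<open>P\<close> are ignored.
\<close>

definition eqH :: "hc \<Rightarrow> hc \<Rightarrow> hc \<Rightarrow> hc" where
  "eqH T \<sigma> f = hset {w \<in> elts (prd P T).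
    (\<forall>\<rho>\<in>elts (PTC \<sigma>). \<forall>r\<in>elts P. kpair \<rho> r \<in> elts \<sigma> \<longrightarrow>
      (\<forall>p\<in>elts P. leq p (kfst w) \<and> leq p r \<longrightarrow> (\<exists>q\<in>elts P. leq q p \<and>
        (\<exists>\<pi>\<in>elts (PTC (ksnd w)). \<exists>s\<in>elts P. kpair \<pi> s \<in> elts (ksnd w) \<and> leq q s \<and>
          kpair q \<pi> \<in> elts (app f \<rho>))))) \<and>
    (\<forall>\<pi>\<in>elts (PTC (ksnd w)). \<forall>s\<in>elts P. kpair \<pi> s \<in> elts (ksnd w) \<longrightarrow>
      (\<forall>p\<in>elts P. leq p (kfst w) \<and> leq p s \<longrightarrow> (\<exists>q\<in>elts P. leq q p \<and>
        (\<exists>\<rho>\<in>elts (PTC \<sigma>). \<exists>r\<in>elts P. kpair \<rho> r \<in> elts \<sigma> \<and> leq q r \<and>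
          kpair q \<pi> \<in> elts (app f \<rho>)))))}"

definition eqrel :: "hc \<Rightarrow> hc \<Rightarrow> hc \<Rightarrow> hc \<Rightarrow> bool" where
  "eqrel T p \<sigma> \<tau> \<longleftrightarrow> kpair p \<tau> \<in> elts (hrec (eqH T) \<sigma>)"

text \<open>Stronger than forcing membership: p already decides which subname of \<tau> equals
  \<sigma>. Forcing membership means that such conditions are dense below p.\<close>

definition memrel :: "hc \<Rightarrow> hc \<Rightarrow> hc \<Rightarrow> hc \<Rightarrow> bool" where
  "memrel T p \<sigma> \<tau> \<longleftrightarrow>
    (\<exists>\<pi>\<in>elts (PTC \<tau>). \<exists>s\<in>elts P. kpair \<pi> s \<in> elts \<tau> \<and> leq p s \<and> eqrel T p \<sigma> \<pi>)"

text \<open>The mirror image of \<open>memrel\<close>, for \<pi> as an element of \<sigma>. The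
  subname of \<sigma> stays on the left of \<open>eqrel\<close> because the recursion runs on the
  left argument.\<close>

definition nirel :: "hc \<Rightarrow> hc \<Rightarrow> hc \<Rightarrow> hc \<Rightarrow> bool" where
  "nirel T p \<sigma> \<pi> \<longleftrightarrow>
    (\<exists>\<rho>\<in>elts (PTC \<sigma>). \<exists>r\<in>elts P. kpair \<rho> r \<in> elts \<sigma> \<and> leq p r \<and> eqrel T p \<rho> \<pi>)"

lemma eqrel_iff:
  "eqrel T p \<sigma> \<tau> \<longleftrightarrow> p \<in> elts P \<and> \<tau> \<in> elts T \<and>
    (\<forall>\<rho>\<in>elts (PTC \<sigma>). \<forall>r\<in>elts P. kpair \<rho> r \<in> elts \<sigma> \<longrightarrow>
      (\<forall>p'\<in>elts P. leq p' p \<and> leq p' r \<longrightarrow> (\<exists>q\<in>elts P. leq q p' \<and> memrel T q \<rho> \<tau>))) \<and>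
    (\<forall>\<pi>\<in>elts (PTC \<tau>). \<forall>s\<in>elts P. kpair \<pi> s \<in> elts \<tau> \<longrightarrow>
      (\<forall>p'\<in>elts P. leq p' p \<and> leq p' s \<longrightarrow> (\<exists>q\<in>elts P. leq q p' \<and> nirel T q \<sigma> \<pi>)))"
proof -
  define f where "f = hset ((\<lambda>z. kpair z (hrec (eqH T) z)) ` elts (PTC \<sigma>))"
  have f: "kpair q \<pi> \<in> elts (app f \<rho>) \<longleftrightarrow> eqrel T q \<rho> \<pi>" if "\<rho> \<in> elts (PTC \<sigma>)" for q \<rho> \<pi>
    using that by (simp add: f_def app_graph eqrel_def)
  have "eqrel T p \<sigma> \<tau> \<longleftrightarrow> kpair p \<tau> \<in> elts (eqH T \<sigma> f)"
    by (simp add: eqrel_def[of T p \<sigma>] hrec.simps[of "eqH T" \<sigma>] f_def)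
  then show ?thesis
    by (simp add: eqH_def memrel_def nirel_def f cong: ball_cong bex_cong)
qed

lemma DF_eqrel:
  assumes "T \<in> M" "TD p" "TD s" "TD t"
  shows "DF (\<lambda>e. eqrel T (p e) (s e) (t e))"
proof -
  have "TD (\<lambda>e. eqH T (e 0) (e (Suc 0)))"
    unfolding eqH_def by (intro TD_intros DF_intros TD_prd TD_const P_M le_M assms(1))
  then show ?thesis
    unfolding eqrel_def by (intro DF_mem TD_kpair TD_hrec assms)
qed

lemma DF_memrel:
  assumes "T \<in> M" "TD p" "TD s" "TD t"
  shows "DF (\<lambda>e. memrel T (p e) (s e) (t e))"
  unfolding memrel_def
  by (intro DF_intros DF_eqrel TD_kpair TD_PTC TD_const P_M le_M
      assms(1) assms(4) TD_ren[OF assms(2)] TD_ren[OF assms(3)] TD_ren[OF assms(4)])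

lemma DF_nirel:
  assumes "T \<in> M" "TD p" "TD s" "TD t"
  shows "DF (\<lambda>e. nirel T (p e) (s e) (t e))"
  unfolding nirel_def
  by (intro DF_intros DF_eqrel TD_kpair TD_PTC TD_const P_M le_M
      assms(1) assms(3) TD_ren[OF assms(2)] TD_ren[OF assms(3)] TD_ren[OF assms(4)])

lemma eqrel_mono: "eqrel T p \<sigma> \<tau> \<Longrightarrow> leq q p \<Longrightarrow> eqrel T q \<sigma> \<tau>"
  unfolding eqrel_iff[of T p \<sigma> \<tau>] eqrel_iff[of T q \<sigma> \<tau>]
  using leq_P[of q p] leq_trans[of _ q p] by blast

lemma memrelI:
  assumes "kpair \<pi> s \<in> elts \<tau>" "leq p s" "eqrel T p \<sigma> \<pi>"
  shows "memrel T p \<sigma> \<tau>"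
  using assms PTC_pair leq_P[OF assms(2)] unfolding memrel_def by blast

lemma memrelE:
  assumes "memrel T p \<sigma> \<tau>"
  obtains \<pi> s where "kpair \<pi> s \<in> elts \<tau>" "leq p s" "eqrel T p \<sigma> \<pi>"
  using assms unfolding memrel_def by blast

lemma nirelI:
  assumes "kpair \<rho> r \<in> elts \<sigma>" "leq p r" "eqrel T p \<rho> \<pi>"
  shows "nirel T p \<sigma> \<pi>"
  using assms PTC_pair leq_P[OF assms(2)] unfolding nirel_def by blast

lemma nirelE:
  assumes "nirel T p \<sigma> \<pi>"
  obtains \<rho> r where "kpair \<rho> r \<in> elts \<sigma>" "leq p r" "eqrel T p \<rho> \<pi>"
  using assms unfolding nirel_def by blast

section \<open>The truth lemma for equality and membership\<close>

lemma valI: "kpair \<sigma> p \<in> elts \<tau> \<Longrightarrow> p \<in> G \<Longrightarrow> val G \<sigma> \<in> elts (val G \<tau>)"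
  by (auto simp: elts_val)

lemma valE:
  assumes "x \<in> elts (val G \<tau>)"
  obtains \<sigma> p where "kpair \<sigma> p \<in> elts \<tau>" "p \<in> G" "x = val G \<sigma>"
  using assms by (auto simp: elts_val)

lemma PTC_M: "\<sigma> \<in> M \<Longrightarrow> \<rho> \<in> elts (PTC \<sigma>) \<Longrightarrow> \<rho> \<in> M"
  using M_trans[OF TD_mem_M[OF TD_PTC[OF TD_const]]] by blast

text \<open>The induction is on the left name alone. Its hypothesis covers all right names in T,
  among which are the subnames of \<tau> by closure of T.\<close>

lemma eq_truth_step:
  assumes T: "T \<in> M" "\<forall>\<pi>\<in>elts T. elts (PTC \<pi>) \<subseteq> elts T"
    and IH: "\<And>\<rho> \<pi>. \<rho> \<in> elts (PTC \<sigma>) \<Longrightarrow> \<pi> \<in> elts T \<Longrightarrow>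
      val G \<rho> = val G \<pi> \<longleftrightarrow> (\<exists>p\<in>G. eqrel T p \<rho> \<pi>)"
    and \<sigma>: "\<sigma> \<in> M" and \<tau>: "\<tau> \<in> elts T"
  shows "val G \<sigma> = val G \<tau> \<longleftrightarrow> (\<exists>p\<in>G. eqrel T p \<sigma> \<tau>)"
proof
  have \<tau>_M: "\<tau> \<in> M" using M_trans[OF T(1) \<tau>] .
  have sub: "\<rho> \<in> elts (PTC \<sigma>)" "\<rho> \<in> M" if "kpair \<rho> r \<in> elts \<sigma>" for \<rho> r
    using PTC_pair[OF that] PTC_M[OF \<sigma>] by auto
  have sub': "\<pi> \<in> elts T" "\<pi> \<in> M" if "kpair \<pi> s \<in> elts \<tau>" for \<pi> s
    using PTC_pair[OF that] T(2) \<tau> M_trans[OF T(1)] by blast+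
  {
    assume "\<exists>p\<in>G. eqrel T p \<sigma> \<tau>"
    then obtain p where p: "p \<in> G" "eqrel T p \<sigma> \<tau>" by blast
    have "val G \<rho> \<in> elts (val G \<tau>)" if \<rho>: "kpair \<rho> r \<in> elts \<sigma>" "r \<in> G" for \<rho> r
    proof -
      obtain p' where p': "p' \<in> G" "leq p' p" "leq p' r"
        using G_common[OF p(1) \<rho>(2)] by blast
      \<comment> \<open>Below p' the conditions that decide a witness are dense, by the recursion
        clause of \<open>eqrel\<close>; hence G contains one.\<close>
      have "\<exists>q\<in>G. memrel T q \<rho> \<tau>"
      proof (rule generic_below[OF _ p'(1)])
        show "DF (\<lambda>e. memrel T (e 0) \<rho> \<tau>)"
          by (intro DF_memrel T TD_var TD_const sub(2)[OF \<rho>(1)] \<tau>_M)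
        show "\<exists>q'. leq q' q \<and> memrel T q' \<rho> \<tau>" if q: "leq q p'" for q
          using p(2) \<rho>(1) sub(1)[OF \<rho>(1)] G_P[OF \<rho>(2)] leq_P[OF q]
            leq_trans[OF q p'(2)] leq_trans[OF q p'(3)]
          unfolding eqrel_iff[of T p \<sigma>] by blast
      qed
      then obtain q where q: "q \<in> G" "memrel T q \<rho> \<tau>" by blast
      from q(2) obtain \<pi> s where "kpair \<pi> s \<in> elts \<tau>" "leq q s" "eqrel T q \<rho> \<pi>"
        by (rule memrelE)
      then show ?thesis
        using IH[OF sub(1)[OF \<rho>(1)] sub'(1)] q(1) valI G_up by metis
    qed
    moreover have "val G \<pi> \<in> elts (val G \<sigma>)" if \<pi>: "kpair \<pi> s \<in> elts \<tau>" "s \<in> G" for \<pi> s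
    proof -
      obtain p' where p': "p' \<in> G" "leq p' p" "leq p' s"
        using G_common[OF p(1) \<pi>(2)] by blast
      have "\<exists>q\<in>G. nirel T q \<sigma> \<pi>"
      proof (rule generic_below[OF _ p'(1)])
        show "DF (\<lambda>e. nirel T (e 0) \<sigma> \<pi>)"
          by (intro DF_nirel T TD_var TD_const sub'(2)[OF \<pi>(1)] \<sigma>)
        show "\<exists>q'. leq q' q \<and> nirel T q' \<sigma> \<pi>" if q: "leq q p'" for q
          using p(2) \<pi>(1) PTC_pair[OF \<pi>(1)] G_P[OF \<pi>(2)] leq_P[OF q]
            leq_trans[OF q p'(2)] leq_trans[OF q p'(3)]
          unfolding eqrel_iff[of T p \<sigma>] by blast
      qed
      then obtain q where q: "q \<in> G" "nirel T q \<sigma> \<pi>" by blast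
      from q(2) obtain \<rho> r where "kpair \<rho> r \<in> elts \<sigma>" "leq q r" "eqrel T q \<rho> \<pi>"
        by (rule nirelE)
      then show ?thesis
        using IH[OF sub(1) sub'(1)[OF \<pi>(1)]] q(1) valI G_up by metis
    qed
    ultimately show "val G \<sigma> = val G \<tau>"
      unfolding hc_ext[of "val G \<sigma>"] by (blast elim: valE)
  }
  {
    assume eq: "val G \<sigma> = val G \<tau>"
    \<comment> \<open>A condition that does not force equality has an extension that shows why: in
      \<open>A\<close> it puts an element into \<sigma> that no stronger condition puts into \<tau>,
      in \<open>B\<close> the other way round. So the disjunction is dense, and equal values exclude
      \<open>A\<close> and \<open>B\<close> on G.\<close>
    define A where "A q \<longleftrightarrow> (\<exists>\<rho>\<in>elts (PTC \<sigma>). \<exists>r\<in>elts P. kpair \<rho> r \<in> elts \<sigma> \<and> leq q r \<and>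
      (\<forall>p\<in>elts P. leq p q \<longrightarrow> \<not> memrel T p \<rho> \<tau>))" for q
    define B where "B q \<longleftrightarrow> (\<exists>\<pi>\<in>elts (PTC \<tau>). \<exists>s\<in>elts P. kpair \<pi> s \<in> elts \<tau> \<and> leq q s \<and>
      (\<forall>p\<in>elts P. leq p q \<longrightarrow> \<not> nirel T p \<sigma> \<pi>))" for q
    have "\<exists>q\<in>G. eqrel T q \<sigma> \<tau> \<or> A q \<or> B q"
    proof (rule generic_below[OF _ o1_G])
      show "DF (\<lambda>e. eqrel T (e 0) \<sigma> \<tau> \<or> A (e 0) \<or> B (e 0))"
        unfolding A_def B_def
        by (intro DF_intros DF_eqrel DF_memrel DF_nirel TD_kpair TD_PTC TD_const P_M le_M \<sigma> \<tau>_M T(1))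
      show "\<exists>q'. leq q' q \<and> (eqrel T q' \<sigma> \<tau> \<or> A q' \<or> B q')" if "leq q o1" for q
      proof (cases "eqrel T q \<sigma> \<tau>")
        case True
        then show ?thesis using leq_refl leq_P[OF that] by blast
      next
        case False
        have "q \<in> elts P" using leq_P[OF that] by blast
        from False consider
          \<rho> r p' where "\<rho> \<in> elts (PTC \<sigma>)" "r \<in> elts P" "kpair \<rho> r \<in> elts \<sigma>" "leq p' q" "leq p' r"
            "\<not> (\<exists>q\<in>elts P. leq q p' \<and> memrel T q \<rho> \<tau>)"
        | \<pi> s p' where "\<pi> \<in> elts (PTC \<tau>)" "s \<in> elts P" "kpair \<pi> s \<in> elts \<tau>" "leq p' q" "leq p' s"
            "\<not> (\<exists>q\<in>elts P. leq q p' \<and> nirel T q \<sigma> \<pi>)"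
          unfolding eqrel_iff[of T q \<sigma>] using \<open>q \<in> elts P\<close> \<tau> by blast
        then show ?thesis
        proof cases
          case 1
          then have "A p'" unfolding A_def by blast
          with 1(4) show ?thesis by blast
        next
          case 2
          then have "B p'" unfolding B_def by blast
          with 2(4) show ?thesis by blast
        qed
      qed
    qed
    then obtain q where q: "q \<in> G" "eqrel T q \<sigma> \<tau> \<or> A q \<or> B q" by blast
    have "\<not> A q"
    proof
      assume "A q"
      then obtain \<rho> r where \<rho>: "kpair \<rho> r \<in> elts \<sigma>" "leq q r"
        and no: "\<And>p. leq p q \<Longrightarrow> \<not> memrel T p \<rho> \<tau>"
        unfolding A_def using leq_P by blast
      have "val G \<rho> \<in> elts (val G \<tau>)"
        using valI[OF \<rho>(1) G_up[OF q(1) \<rho>(2)]] eq by simp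
      then obtain \<pi> s where \<pi>: "kpair \<pi> s \<in> elts \<tau>" "s \<in> G" "val G \<rho> = val G \<pi>"
        by (rule valE)
      then obtain p where p: "p \<in> G" "eqrel T p \<rho> \<pi>"
        using IH[OF sub(1)[OF \<rho>(1)] sub'(1)] by blast
      obtain p' where p': "p' \<in> G" "leq p' p" "leq p' q" using G_common[OF p(1) q(1)] by blast
      obtain p'' where p'': "p'' \<in> G" "leq p'' p'" "leq p'' s" using G_common[OF p'(1) \<pi>(2)] by blast
      have "memrel T p'' \<rho> \<tau>"
        by (rule memrelI[OF \<pi>(1) p''(3) eqrel_mono[OF p(2) leq_trans[OF p''(2) p'(2)]]])
      with no[OF leq_trans[OF p''(2) p'(3)]] show False by blast
    qed
    moreover have "\<not> B q"
    proof
      assume "B q"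
      then obtain \<pi> s where \<pi>: "kpair \<pi> s \<in> elts \<tau>" "leq q s"
        and no: "\<And>p. leq p q \<Longrightarrow> \<not> nirel T p \<sigma> \<pi>"
        unfolding B_def using leq_P by blast
      have "val G \<pi> \<in> elts (val G \<sigma>)"
        using valI[OF \<pi>(1) G_up[OF q(1) \<pi>(2)]] eq by simp
      then obtain \<rho> r where \<rho>: "kpair \<rho> r \<in> elts \<sigma>" "r \<in> G" "val G \<pi> = val G \<rho>"
        by (rule valE)
      then obtain p where p: "p \<in> G" "eqrel T p \<rho> \<pi>"
        using IH[OF sub(1)[OF \<rho>(1)] sub'(1)[OF \<pi>(1)]] by auto
      obtain p' where p': "p' \<in> G" "leq p' p" "leq p' q" using G_common[OF p(1) q(1)] by blast
      obtain p'' where p'': "p'' \<in> G" "leq p'' p'" "leq p'' r" using G_common[OF p'(1) \<rho>(2)] by blast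
      have "nirel T p'' \<sigma> \<pi>"
        by (rule nirelI[OF \<rho>(1) p''(3) eqrel_mono[OF p(2) leq_trans[OF p''(2) p'(2)]]])
      with no[OF leq_trans[OF p''(2) p'(3)]] show False by blast
    qed
    ultimately show "\<exists>p\<in>G. eqrel T p \<sigma> \<tau>" using q by blast
  }
qed

lemma eq_truth:
  assumes T: "T \<in> M" "\<forall>\<pi>\<in>elts T. elts (PTC \<pi>) \<subseteq> elts T"
  shows "\<sigma> \<in> M \<Longrightarrow> \<tau> \<in> elts T \<Longrightarrow> val G \<sigma> = val G \<tau> \<longleftrightarrow> (\<exists>p\<in>G. eqrel T p \<sigma> \<tau>)"
proof (induction \<sigma> arbitrary: \<tau> rule: PTC_induct)
  case (1 \<sigma>)
  show ?case
    by (rule eq_truth_step[OF T 1(1) 1(2,3)]) (use PTC_M[OF 1(2)] in blast)+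
qed

lemma mem_truth:
  assumes T: "T \<in> M" "\<forall>\<pi>\<in>elts T. elts (PTC \<pi>) \<subseteq> elts T"
    and \<sigma>: "\<sigma> \<in> M" and \<tau>: "elts (PTC \<tau>) \<subseteq> elts T"
  shows "val G \<sigma> \<in> elts (val G \<tau>) \<longleftrightarrow> (\<exists>p\<in>G. memrel T p \<sigma> \<tau>)"
proof
  assume "val G \<sigma> \<in> elts (val G \<tau>)"
  then obtain \<pi> s where \<pi>: "kpair \<pi> s \<in> elts \<tau>" "s \<in> G" "val G \<sigma> = val G \<pi>"
    by (rule valE)
  then obtain p where p: "p \<in> G" "eqrel T p \<sigma> \<pi>"
    using eq_truth[OF T \<sigma>, where \<tau> = \<pi>] PTC_pair[OF \<pi>(1)] \<tau> by blast
  obtain q where "q \<in> G" "leq q p" "leq q s" using G_common[OF p(1) \<pi>(2)] by blast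
  then show "\<exists>p\<in>G. memrel T p \<sigma> \<tau>"
    using memrelI[OF \<pi>(1)] eqrel_mono[OF p(2)] by blast
next
  assume "\<exists>p\<in>G. memrel T p \<sigma> \<tau>"
  then obtain p where p: "p \<in> G" "memrel T p \<sigma> \<tau>" by blast
  from p(2) obtain \<pi> s where \<pi>: "kpair \<pi> s \<in> elts \<tau>" "leq p s" "eqrel T p \<sigma> \<pi>"
    by (rule memrelE)
  then have "val G \<sigma> = val G \<pi>"
    using eq_truth[OF T \<sigma>, where \<tau> = \<pi>] PTC_pair[OF \<pi>(1)] \<tau> p(1) by blast
  then show "val G \<sigma> \<in> elts (val G \<tau>)"
    using valI[OF \<pi>(1) G_up[OF p(1) \<pi>(2)]] by simp
qed

lemma memrel_mono: "memrel T p \<sigma> \<tau> \<Longrightarrow> leq q p \<Longrightarrow> memrel T q \<sigma> \<tau>"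
  by (meson memrelE memrelI eqrel_mono leq_trans)

end

section \<open>Closure properties of generic extensions\<close>

text \<open>The check name of x for a forcing with largest element o1.\<close>

definition chk :: "hc \<Rightarrow> hc \<Rightarrow> hc" where
  "chk o1 = hrec (\<lambda>x f. hset ((\<lambda>y. kpair (app f y) o1) ` elts x))"

lemma elts_chk: "elts (chk o1 x) = {kpair (chk o1 y) o1 | y. y \<in> elts x}"
proof -
  have "y \<in> elts (PTC x)" if "y \<in> elts x" for y
    using that by (auto simp: elts_PTC)
  then show ?thesis
    unfolding chk_def by (subst hrec.simps) (auto simp: app_graph)
qed

lemma is_name_chk: "o1 \<in> elts P \<Longrightarrow> is_name P (chk o1 x)"
proof (induction x rule: hc_induct)
  case (1 x)
  show ?case by (rule is_name.intros) (use 1 in \<open>auto simp: elts_chk\<close>)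
qed

lemma val_chk: "o1 \<in> G \<Longrightarrow> val G (chk o1 x) = x"
proof (induction x rule: hc_induct)
  case (1 x)
  have "elts (val G (chk o1 x)) = {val G (chk o1 y) | y. y \<in> elts x}"
    using 1(2) by (simp add: elts_val elts_chk) blast
  also have "\<dots> = (\<lambda>y. val G (chk o1 y)) ` elts x" by blast
  also have "\<dots> = (\<lambda>y. y) ` elts x"
    using 1 by (intro image_cong) simp_all
  finally show ?case by (simp add: hc_ext)
qed

context generic_extension
begin

section \<open>Recursion on names\<close>

definition opn :: "hc \<Rightarrow> hc \<Rightarrow> hc" where
  "opn a b = hset {kpair (hset {kpair a o1}) o1, kpair (hset {kpair a o1, kpair b o1}) o1}"

lemma val_opn: "val G (opn a b) = kpair (val G a) (val G b)"
proof -
  have *: "elts (val G (hset {kpair c o1, kpair d o1})) = {val G c, val G d}" for c d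
    using o1_G by (auto simp: elts_val)
  have up: "val G (hset {kpair c o1, kpair d o1}) = hset {val G c, val G d}" for c d
    by (simp add: hc_ext *)
  show ?thesis
    using up[of a a] by (simp add: opn_def kpair_def[of "val G a"] up)
qed

lemma TD_opn: "TD s \<Longrightarrow> TD t \<Longrightarrow> TD (\<lambda>e. opn (s e) (t e))"
  by (rule TD_fun2[where H = opn]) (unfold opn_def, intro TD_intros TD_const o1_M)

lemma opn_M: "a \<in> M \<Longrightarrow> b \<in> M \<Longrightarrow> opn a b \<in> M"
  by (intro TD_mem_M[OF TD_opn] TD_const)

text \<open>A common scheme for the names built below: \<open>S\<close> selects the pairs of subname
  and condition that are used, and \<open>t\<close> wraps the result of the recursive call.\<close>

definition name_map :: "(hc \<Rightarrow> hc) \<Rightarrow> (hc \<Rightarrow> hc) \<Rightarrow> hc \<Rightarrow> hc" where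
  "name_map t S = hrec (\<lambda>\<sigma> f.
    hset ((\<lambda>w. kpair (t (app f (kfst w))) (ksnd w)) ` elts (S \<sigma>)))"

lemma elts_name_map:
  assumes "elts (S \<sigma>) \<subseteq> elts (prd (PTC \<sigma>) P)"
  shows "elts (name_map t S \<sigma>) = {kpair (t (name_map t S \<rho>)) p | \<rho> p. kpair \<rho> p \<in> elts (S \<sigma>)}"
proof -
  define f where "f = hset ((\<lambda>z. kpair z (name_map t S z)) ` elts (PTC \<sigma>))"
  have f: "app f \<rho> = name_map t S \<rho>" if "\<rho> \<in> elts (PTC \<sigma>)" for \<rho>
    using that by (simp add: f_def app_graph)
  have w: "\<exists>\<rho> p. w = kpair \<rho> p \<and> \<rho> \<in> elts (PTC \<sigma>)" if "w \<in> elts (S \<sigma>)" for w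
    using that assms by (auto simp: elts_prd)
  have "elts (name_map t S \<sigma>) = (\<lambda>w. kpair (t (app f (kfst w))) (ksnd w)) ` elts (S \<sigma>)"
    unfolding f_def name_map_def by (subst hrec.simps) simp
  also have "\<dots> = {kpair (t (name_map t S \<rho>)) p | \<rho> p. kpair \<rho> p \<in> elts (S \<sigma>)}"
  proof (intro equalityI subsetI)
    fix v assume "v \<in> (\<lambda>w. kpair (t (app f (kfst w))) (ksnd w)) ` elts (S \<sigma>)"
    then obtain w where v: "w \<in> elts (S \<sigma>)" "v = kpair (t (app f (kfst w))) (ksnd w)" by blast
    from w[OF v(1)] obtain \<rho> p where "w = kpair \<rho> p" "\<rho> \<in> elts (PTC \<sigma>)" by blast
    with v f show "v \<in> {kpair (t (name_map t S \<rho>)) p | \<rho> p. kpair \<rho> p \<in> elts (S \<sigma>)}" by auto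
  next
    fix v assume "v \<in> {kpair (t (name_map t S \<rho>)) p | \<rho> p. kpair \<rho> p \<in> elts (S \<sigma>)}"
    then obtain \<rho> p where v: "kpair \<rho> p \<in> elts (S \<sigma>)" "v = kpair (t (name_map t S \<rho>)) p" by blast
    from w[OF v(1)] have "\<rho> \<in> elts (PTC \<sigma>)" by auto
    with v f show "v \<in> (\<lambda>w. kpair (t (app f (kfst w))) (ksnd w)) ` elts (S \<sigma>)"
      by (intro image_eqI[of _ _ "kpair \<rho> p"]) simp_all
  qed
  finally show ?thesis .
qed

lemma name_map_M:
  assumes "TD (\<lambda>e. t (e 0))" "TD (\<lambda>e. S (e 0))" "\<sigma> \<in> M"
  shows "name_map t S \<sigma> \<in> M"
proof -
  have "TD (\<lambda>e. hset ((\<lambda>w. kpair (t (app (e (Suc 0)) (kfst w))) (ksnd w)) ` elts (S (e 0))))"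
    by (intro TD_intros TD_fun1[OF assms(1)] TD_fun1[OF assms(2)])
  then show ?thesis
    unfolding name_map_def using assms(3) by (intro TD_mem_M[OF TD_hrec] TD_const)
qed

definition subnames :: "hc \<Rightarrow> hc" where
  "subnames \<sigma> = hset {w \<in> elts (prd (PTC \<sigma>) P). w \<in> elts \<sigma>}"

lemma kpair_subnames: "kpair \<rho> p \<in> elts (subnames \<sigma>) \<longleftrightarrow> kpair \<rho> p \<in> elts \<sigma> \<and> p \<in> elts P"
  using PTC_pair by (auto simp: subnames_def)

lemma subnames_subset: "elts (subnames \<sigma>) \<subseteq> elts (prd (PTC \<sigma>) P)"
  by (simp add: subnames_def)

lemma TD_subnames: "TD (\<lambda>e. subnames (e 0))"
  unfolding subnames_def by (intro TD_intros DF_intros TD_prd TD_const P_M)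

definition active :: "hc \<Rightarrow> hc set" where
  "active \<sigma> = {\<rho>. \<exists>p\<in>G. kpair \<rho> p \<in> elts \<sigma>}"

lemma active_PTC: "\<rho> \<in> active \<sigma> \<Longrightarrow> \<rho> \<in> elts (PTC \<sigma>)"
  using PTC_pair by (auto simp: active_def)

lemma elts_val_active: "elts (val G \<sigma>) = val G ` active \<sigma>"
  by (auto simp: elts_val active_def)

lemma elts_val_map:
  assumes "elts \<tau> = {kpair (f \<rho>) p | \<rho> p. kpair \<rho> p \<in> elts \<sigma> \<and> p \<in> elts P}"
  shows "elts (val G \<tau>) = (\<lambda>\<rho>. val G (f \<rho>)) ` active \<sigma>"
proof -
  have "active \<tau> = f ` active \<sigma>"
    using G_P by (force simp: active_def assms)
  then show ?thesis by (simp add: elts_val_active image_image)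
qed

definition nm :: "hc \<Rightarrow> hc" where
  "nm = name_map (\<lambda>x. x) subnames"

lemma elts_nm: "elts (nm \<sigma>) = {kpair (nm \<rho>) p | \<rho> p. kpair \<rho> p \<in> elts \<sigma> \<and> p \<in> elts P}"
  unfolding nm_def
  by (subst elts_name_map[where S = subnames, OF subnames_subset]) (simp add: kpair_subnames)

lemma nm_M: "\<sigma> \<in> M \<Longrightarrow> nm \<sigma> \<in> M"
  unfolding nm_def by (intro name_map_M TD_var TD_subnames)

lemma is_name_nm: "is_name P (nm \<sigma>)"
proof (induction \<sigma> rule: PTC_induct)
  case (1 \<sigma>)
  show ?case by (rule is_name.intros) (use 1 PTC_pair in \<open>force simp: elts_nm\<close>)
qed

lemma val_nm: "val G (nm \<sigma>) = val G \<sigma>"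
proof (induction \<sigma> rule: PTC_induct)
  case (1 \<sigma>)
  have "elts (val G (nm \<sigma>)) = (\<lambda>\<rho>. val G (nm \<rho>)) ` active \<sigma>"
    by (rule elts_val_map[OF elts_nm])
  also have "\<dots> = val G ` active \<sigma>"
    using 1 active_PTC by (intro image_cong) simp_all
  finally show ?case by (simp add: hc_ext elts_val_active)
qed

text \<open>Members that are not pairs with a condition never contribute to a value, and
  \<open>nm\<close> removes them hereditarily within M. Hence every element of M may serve as a
  name.\<close>

lemma gen_ext_eq: "gen_ext M P G = val G ` M"
proof
  show "val G ` M \<subseteq> gen_ext M P G"
  proof (rule image_subsetI)
    fix \<sigma> assume "\<sigma> \<in> M"
    then have "val G (nm \<sigma>) \<in> gen_ext M P G"
      unfolding gen_ext_def using nm_M is_name_nm by blast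
    then show "val G \<sigma> \<in> gen_ext M P G" by (simp only: val_nm)
  qed
qed (auto simp: gen_ext_def)

lemma N_trans: "x \<in> gen_ext M P G \<Longrightarrow> y \<in> elts x \<Longrightarrow> y \<in> gen_ext M P G"
  unfolding gen_ext_eq using PTC_pair PTC_M by (auto elim!: valE)

text \<open>A name for a check name: the value of c plays the largest element of a second forcing
  that lives in the extension, and \<open>hat c \<sigma>\<close> names the check name of
  \<open>val G \<sigma>\<close> for it.\<close>

definition hat :: "hc \<Rightarrow> hc \<Rightarrow> hc" where
  "hat c = name_map (\<lambda>x. opn x c) subnames"

lemma elts_hat:
  "elts (hat c \<sigma>) = {kpair (opn (hat c \<rho>) c) p | \<rho> p. kpair \<rho> p \<in> elts \<sigma> \<and> p \<in> elts P}"
  unfolding hat_def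
  by (subst elts_name_map[where S = subnames, OF subnames_subset]) (simp add: kpair_subnames)

lemma TD_hat: "c \<in> M \<Longrightarrow> TD s \<Longrightarrow> TD (\<lambda>e. hat c (s e))"
  unfolding hat_def name_map_def
  by (intro TD_hrec TD_intros TD_opn TD_const TD_fun1[OF TD_subnames])

lemma val_hat: "val G (hat c \<sigma>) = chk (val G c) (val G \<sigma>)"
proof (induction \<sigma> rule: PTC_induct)
  case (1 \<sigma>)
  have "elts (val G (hat c \<sigma>)) = (\<lambda>\<rho>. val G (opn (hat c \<rho>) c)) ` active \<sigma>"
    by (rule elts_val_map[OF elts_hat])
  also have "\<dots> = (\<lambda>\<rho>. kpair (chk (val G c) (val G \<rho>)) (val G c)) ` active \<sigma>"
    using 1 active_PTC by (intro image_cong) (simp_all add: val_opn)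
  also have "\<dots> = elts (chk (val G c) (val G \<sigma>))"
    by (auto simp: elts_chk elts_val_active)
  finally show ?case by (simp add: hc_ext)
qed

lemma chk_gen_ext:
  assumes "a \<in> gen_ext M P G" "x \<in> gen_ext M P G"
  shows "chk a x \<in> gen_ext M P G"
proof -
  obtain c \<sigma> where c: "c \<in> M" "a = val G c" and \<sigma>: "\<sigma> \<in> M" "x = val G \<sigma>"
    using assms by (auto simp: gen_ext_eq)
  have "hat c \<sigma> \<in> M" by (intro TD_mem_M[OF TD_hat] TD_const c \<sigma>)
  then have "val G (hat c \<sigma>) \<in> gen_ext M P G" unfolding gen_ext_eq by (rule imageI)
  then show ?thesis by (simp add: val_hat c \<sigma>)
qed

text \<open>With x the conditions and a the largest element of a second forcing, this is the
  canonical name of its generic filter.\<close>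

lemma canonical_name_gen_ext:
  assumes "a \<in> gen_ext M P G" "x \<in> gen_ext M P G"
  shows "hset ((\<lambda>q. kpair (chk a q) q) ` elts x) \<in> gen_ext M P G"
proof -
  obtain c \<sigma> where c: "c \<in> M" "a = val G c" and \<sigma>: "\<sigma> \<in> M" "x = val G \<sigma>"
    using assms by (auto simp: gen_ext_eq)
  define \<tau> where "\<tau> = hset ((\<lambda>w. kpair (opn (hat c (kfst w)) (kfst w)) (ksnd w)) ` elts (subnames \<sigma>))"
  have "\<tau> \<in> M"
    unfolding \<tau>_def
    by (intro TD_mem_M[OF TD_image] TD_intros TD_opn TD_hat TD_fun1[OF TD_subnames] TD_const c \<sigma>)
  moreover have "elts \<tau> = {kpair (opn (hat c \<rho>) \<rho>) p | \<rho> p. kpair \<rho> p \<in> elts \<sigma> \<and> p \<in> elts P}"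
  proof -
    have "elts \<tau> = {kpair (opn (hat c \<rho>) \<rho>) p | \<rho> p. kpair \<rho> p \<in> elts (subnames \<sigma>)}"
      using subnames_subset[of \<sigma>] by (force simp: \<tau>_def elts_prd)
    then show ?thesis by (simp add: kpair_subnames)
  qed
  then have "elts (val G \<tau>) = (\<lambda>\<rho>. val G (opn (hat c \<rho>) \<rho>)) ` active \<sigma>"
    by (rule elts_val_map)
  then have "elts (val G \<tau>) = (\<lambda>q. kpair (chk a q) q) ` elts x"
    by (simp add: val_opn val_hat c \<sigma> elts_val_active image_image)
  then have "val G \<tau> = hset ((\<lambda>q. kpair (chk a q) q) ` elts x)"
    by (simp add: hc_ext)
  ultimately show ?thesis unfolding gen_ext_eq by (metis imageI)
qed

text \<open>
  Given names \<open>X'\<close> of \<open>X\<close> and \<open>\<sigma>\<close> of \<open>y\<close>, the name \<open>F \<sigma>\<close> of \<open>val X y\<close> consists of the pairs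
  \<open>(F \<rho>, p)\<close> such that \<open>p\<close> forces \<open>(\<rho>, \<pi>) \<in> \<sigma>\<close> and \<open>\<pi> \<in> X'\<close> for some \<open>\<pi>\<close>. It suffices to take \<open>\<rho>\<close> and
  \<open>\<pi>\<close> in the transitive closure of \<open>\<sigma>\<close>, since a Kuratowski pair contains its components hereditarily.
\<close>

lemma val_gen_ext:
  assumes "X \<in> gen_ext M P G" "y \<in> gen_ext M P G"
  shows "val (elts X) y \<in> gen_ext M P G"
proof -
  obtain X' \<sigma>0 where X': "X' \<in> M" "X = val G X'" and \<sigma>0: "\<sigma>0 \<in> M" "y = val G \<sigma>0"
    using assms by (auto simp: gen_ext_eq)
  \<comment> \<open>\<open>mem_truth\<close> bounds the right names by T, here X' and the names met
    below \<sigma>0. The left names, among them \<open>opn \<rho> \<pi>\<close>, range over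
    M.\<close>
  define T where "T = hset (elts (TC X') \<union> elts (TC \<sigma>0))"
  have T_M: "T \<in> M"
    unfolding T_def by (intro TD_mem_M[OF TD_Un] TD_TC TD_const X' \<sigma>0)
  have T_sub: "\<forall>\<pi>\<in>elts T. elts (PTC \<pi>) \<subseteq> elts T"
    using PTC_TC by (auto simp: T_def)
  have \<sigma>0_T: "\<sigma>0 \<in> elts T" and "X' \<in> elts T"
    by (simp_all add: T_def)
  then have X'_T: "elts (PTC X') \<subseteq> elts T" using T_sub by blast
  define S where "S \<sigma> = hset {w \<in> elts (prd (PTC \<sigma>) P). \<exists>\<pi>\<in>elts (PTC \<sigma>).
    memrel T (ksnd w) (opn (kfst w) \<pi>) \<sigma> \<and> memrel T (ksnd w) \<pi> X'}" for \<sigma>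
  have kpair_S: "kpair \<rho> p \<in> elts (S \<sigma>) \<longleftrightarrow> \<rho> \<in> elts (PTC \<sigma>) \<and> p \<in> elts P \<and>
    (\<exists>\<pi>\<in>elts (PTC \<sigma>). memrel T p (opn \<rho> \<pi>) \<sigma> \<and> memrel T p \<pi> X')" for \<rho> p \<sigma>
    by (simp add: S_def)
  have S_sub: "elts (S \<sigma>) \<subseteq> elts (prd (PTC \<sigma>) P)" for \<sigma>
    by (simp add: S_def)
  have "TD (\<lambda>e. S (e 0))"
    unfolding S_def
    by (intro TD_intros DF_intros DF_memrel TD_opn TD_prd TD_const P_M T_M X')
  define F where "F = name_map (\<lambda>x. x) S"
  have F_M: "F \<sigma>0 \<in> M"
    unfolding F_def by (intro name_map_M TD_var \<open>TD (\<lambda>e. S (e 0))\<close> \<sigma>0)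
  have elts_F: "elts (F \<sigma>) = {kpair (F \<rho>) p | \<rho> p. kpair \<rho> p \<in> elts (S \<sigma>)}" for \<sigma>
    unfolding F_def by (rule elts_name_map[OF S_sub])
  have "\<sigma> \<in> elts T \<longrightarrow> val G (F \<sigma>) = val (elts X) (val G \<sigma>)" for \<sigma>
  proof (induction \<sigma> rule: PTC_induct)
    case (1 \<sigma>)
    show ?case
    proof
      assume \<sigma>: "\<sigma> \<in> elts T"
      have sub: "\<rho> \<in> elts T" "\<rho> \<in> M" if "\<rho> \<in> elts (PTC \<sigma>)" for \<rho>
        using T_sub \<sigma> that M_trans[OF T_M] by blast+
      have IH: "val G (F \<rho>) = val (elts X) (val G \<rho>)" if "\<rho> \<in> elts (PTC \<sigma>)" for \<rho>
        using 1[OF that] sub[OF that] by blast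
      have mem_\<sigma>: "val G \<rho> \<in> elts (val G \<sigma>) \<longleftrightarrow> (\<exists>p\<in>G. memrel T p \<rho> \<sigma>)" if "\<rho> \<in> M" for \<rho>
        using mem_truth[OF T_M T_sub that] T_sub \<sigma> by blast
      have mem_X: "val G \<rho> \<in> elts X \<longleftrightarrow> (\<exists>p\<in>G. memrel T p \<rho> X')" if "\<rho> \<in> M" for \<rho>
        using mem_truth[OF T_M T_sub that X'_T] X' by simp
      have "elts (val G (F \<sigma>)) \<subseteq> elts (val (elts X) (val G \<sigma>))"
      proof
        fix x assume "x \<in> elts (val G (F \<sigma>))"
        then obtain \<rho> p where p: "p \<in> G" "x = val G (F \<rho>)" "kpair \<rho> p \<in> elts (S \<sigma>)"
          by (auto simp: elts_val elts_F)
        then obtain \<pi> where \<rho>: "\<rho> \<in> elts (PTC \<sigma>)" and \<pi>: "\<pi> \<in> elts (PTC \<sigma>)"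
          and "memrel T p (opn \<rho> \<pi>) \<sigma>" "memrel T p \<pi> X'"
          using kpair_S by blast
        then have "val G (opn \<rho> \<pi>) \<in> elts (val G \<sigma>)" "val G \<pi> \<in> elts X"
          using mem_\<sigma>[OF opn_M] mem_X sub(2) p(1) by blast+
        then show "x \<in> elts (val (elts X) (val G \<sigma>))"
          using p(2) IH[OF \<rho>] by (auto simp: elts_val[of "elts X"] val_opn)
      qed
      moreover have "elts (val (elts X) (val G \<sigma>)) \<subseteq> elts (val G (F \<sigma>))"
      proof
        fix x assume "x \<in> elts (val (elts X) (val G \<sigma>))"
        then obtain a b where x: "x = val (elts X) a" "b \<in> elts X" "kpair a b \<in> elts (val G \<sigma>)"
          by (auto simp: elts_val[of "elts X"])
        obtain \<rho> \<pi> where \<rho>: "\<rho> \<in> elts (PTC \<sigma>)" "a = val G \<rho>" and \<pi>: "\<pi> \<in> elts (PTC \<sigma>)" "b = val G \<pi>"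
        proof -
          obtain \<tau> q where \<tau>: "kpair \<tau> q \<in> elts \<sigma>" "kpair a b = val G \<tau>"
            using x(3) by (rule valE) auto
          have "hset {a, b} \<in> elts (val G \<tau>)"
            unfolding \<tau>(2)[symmetric] by (simp add: kpair_def)
          then obtain \<tau>' q' where \<tau>': "kpair \<tau>' q' \<in> elts \<tau>" "hset {a, b} = val G \<tau>'"
            by (rule valE)
          have "a \<in> elts (val G \<tau>')" "b \<in> elts (val G \<tau>')"
            unfolding \<tau>'(2)[symmetric] by simp_all
          then obtain \<rho> \<pi> r s where *: "kpair \<rho> r \<in> elts \<tau>'" "a = val G \<rho>"
            "kpair \<pi> s \<in> elts \<tau>'" "b = val G \<pi>"
            by (elim valE) blast
          have "\<tau>' \<in> elts (PTC \<sigma>)"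
            by (rule PTC_trans[OF PTC_pair[OF \<tau>'(1)] PTC_pair[OF \<tau>(1)]])
          then show ?thesis
            using that * PTC_trans[OF PTC_pair] by blast
        qed
        have "\<exists>p\<in>G. memrel T p (opn \<rho> \<pi>) \<sigma>"
          using mem_\<sigma>[OF opn_M[OF sub(2)[OF \<rho>(1)] sub(2)[OF \<pi>(1)]]] x(3) \<rho>(2) \<pi>(2)
          by (simp add: val_opn)
        then obtain p where p: "p \<in> G" "memrel T p (opn \<rho> \<pi>) \<sigma>" by blast
        obtain q where q: "q \<in> G" "memrel T q \<pi> X'"
          using mem_X[OF sub(2)[OF \<pi>(1)]] x(2) \<pi>(2) by blast
        obtain r where r: "r \<in> G" "leq r p" "leq r q"
          using G_common[OF p(1) q(1)] by blast
        have "kpair \<rho> r \<in> elts (S \<sigma>)"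
          unfolding kpair_S using \<rho>(1) \<pi>(1) G_P[OF r(1)] memrel_mono[OF p(2) r(2)]
            memrel_mono[OF q(2) r(3)] by blast
        then have "val G (F \<rho>) \<in> elts (val G (F \<sigma>))"
          using valI[OF _ r(1)] elts_F by blast
        then show "x \<in> elts (val G (F \<sigma>))"
          using IH[OF \<rho>(1)] x(1) \<rho>(2) by simp
      qed
      ultimately show "val G (F \<sigma>) = val (elts X) (val G \<sigma>)"
        by (simp add: hc_ext[of "val G (F \<sigma>)"])
    qed
  qed
  then show ?thesis
    unfolding gen_ext_eq using imageI[OF F_M, of "val G"] \<sigma>0 \<sigma>0_T by simp
qed

text \<open>Nice names: an element of a subset x of u has a name occurring in \<upsilon>, so x is
  the value of the set R of pairs (\<pi>, p) with \<open>memrel T p \<pi> \<tau>\<close>. All such R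
  are subsets of the fixed set A, and the power set of A in M, with o1 attached to each member,
  names w.\<close>

lemma weak_power_set_gen_ext:
  assumes "u \<in> gen_ext M P G"
  shows "\<exists>w\<in>gen_ext M P G. \<forall>x\<in>gen_ext M P G. elts x \<subseteq> elts u \<longrightarrow> x \<in> elts w"
proof -
  obtain \<upsilon> where \<upsilon>: "\<upsilon> \<in> M" "u = val G \<upsilon>"
    using assms by (auto simp: gen_ext_eq)
  define A where "A = prd (PTC \<upsilon>) P"
  have A_M: "A \<in> M" unfolding A_def by (intro TD_mem_M[OF TD_prd] TD_PTC TD_const P_M \<upsilon>)
  define \<omega> where "\<omega> = hset ((\<lambda>R. kpair R o1) ` elts (hset {z \<in> M. elts z \<subseteq> elts A}))"
  have "\<omega> \<in> M"
    unfolding \<omega>_def by (intro TD_mem_M[OF TD_image] TD_intros TD_const o1_M A_M)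
  have "x \<in> elts (val G \<omega>)" if x: "x \<in> gen_ext M P G" "elts x \<subseteq> elts u" for x
  proof -
    obtain \<tau> where \<tau>: "\<tau> \<in> M" "x = val G \<tau>" using x(1) by (auto simp: gen_ext_eq)
    define T where "T = TC \<tau>"
    have T_M: "T \<in> M" unfolding T_def by (intro TD_mem_M[OF TD_TC] TD_const \<tau>)
    have T_sub: "\<forall>\<pi>\<in>elts T. elts (PTC \<pi>) \<subseteq> elts T"
      using PTC_TC by (auto simp: T_def)
    define R where "R = hset {w \<in> elts A. memrel T (ksnd w) (kfst w) \<tau>}"
    have "R \<in> M"
      unfolding R_def by (intro TD_mem_M[OF TD_sep] TD_intros DF_memrel TD_const A_M T_M \<tau>)
    moreover have "elts R \<subseteq> elts A" by (auto simp: R_def)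
    ultimately have "kpair R o1 \<in> elts \<omega>"
      using countable_M[of "{z \<in> M. elts z \<subseteq> elts A}"] by (auto simp: \<omega>_def)
    then have "val G R \<in> elts (val G \<omega>)" by (rule valI[OF _ o1_G])
    moreover have "val G R = x"
    proof -
      have mem: "val G \<pi> \<in> elts x \<longleftrightarrow> (\<exists>p\<in>G. memrel T p \<pi> \<tau>)" if "\<pi> \<in> elts (PTC \<upsilon>)" for \<pi>
        using mem_truth[OF T_M T_sub PTC_M[OF \<upsilon>(1) that], of \<tau>] T_sub \<tau>(2) by (simp add: T_def)
      have R: "kpair \<pi> p \<in> elts R \<longleftrightarrow> \<pi> \<in> elts (PTC \<upsilon>) \<and> p \<in> elts P \<and> memrel T p \<pi> \<tau>" for \<pi> p
        by (simp add: R_def A_def)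
      have "elts (val G R) = elts x"
      proof (intro equalityI subsetI)
        fix y assume "y \<in> elts (val G R)"
        then obtain \<pi> p where "kpair \<pi> p \<in> elts R" "p \<in> G" "y = val G \<pi>" by (rule valE)
        then show "y \<in> elts x" using mem R by blast
      next
        fix y assume y: "y \<in> elts x"
        then have "y \<in> elts (val G \<upsilon>)" using x(2) \<upsilon>(2) by blast
        then obtain \<pi> s where \<pi>: "kpair \<pi> s \<in> elts \<upsilon>" "y = val G \<pi>" by (rule valE)
        then obtain p where "p \<in> G" "memrel T p \<pi> \<tau>" using mem[OF PTC_pair] y by blast
        then show "y \<in> elts (val G R)"
          using valI[of \<pi> p R] R PTC_pair[OF \<pi>(1)] G_P \<pi>(2) by blast
      qed
      then show ?thesis by (simp add: hc_ext)
    qed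
    ultimately show ?thesis by simp
  qed
  moreover have "val G \<omega> \<in> gen_ext M P G"
    using \<open>\<omega> \<in> M\<close> by (simp add: gen_ext_eq)
  ultimately show ?thesis by blast
qed

end

section \<open>The multiverse\<close>

context
  fixes M :: "hc set" and \<gamma> :: fm
  assumes ctm_M: "ctm_ZFC M"
begin

text \<open>Each model of the multiverse is a single generic extension of M, so the closure
  properties shown for M[G] carry over to it.\<close>

lemma multiverse_induct [consumes 1, case_names gen_ext]:
  assumes "N \<in> multiverse \<gamma> M"
    and "\<And>P le o1 G. generic_extension M P le o1 G \<Longrightarrow> Q (gen_ext M P G)"
  shows "Q N"
proof -
  obtain P le o1 G where *: "in_class \<gamma> M P le o1" "generic_over M P le o1 G" "N = gen_ext M P G"
    using assms(1) unfolding multiverse_def extends_def by blast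
  then have "generic_extension M P le o1 G"
    using ctm_M by unfold_locales (simp_all add: in_class_def)
  then show ?thesis unfolding *(3) by (rule assms(2))
qed

lemma multiverse_trans: "N \<in> multiverse \<gamma> M \<Longrightarrow> x \<in> N \<Longrightarrow> y \<in> elts x \<Longrightarrow> y \<in> N"
  by (induction N rule: multiverse_induct) (rule generic_extension.N_trans)

lemma multiverse_chk: "N \<in> multiverse \<gamma> M \<Longrightarrow> a \<in> N \<Longrightarrow> x \<in> N \<Longrightarrow> chk a x \<in> N"
  by (induction N rule: multiverse_induct) (rule generic_extension.chk_gen_ext)

lemma multiverse_canonical_name:
  "N \<in> multiverse \<gamma> M \<Longrightarrow> a \<in> N \<Longrightarrow> x \<in> N \<Longrightarrow> hset ((\<lambda>q. kpair (chk a q) q) ` elts x) \<in> N"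
  by (induction N rule: multiverse_induct) (rule generic_extension.canonical_name_gen_ext)

lemma multiverse_val: "N \<in> multiverse \<gamma> M \<Longrightarrow> x \<in> N \<Longrightarrow> y \<in> N \<Longrightarrow> val (elts x) y \<in> N"
  by (induction N rule: multiverse_induct) (rule generic_extension.val_gen_ext)

lemma multiverse_weak_power_set:
  "N \<in> multiverse \<gamma> M \<Longrightarrow> u \<in> N \<Longrightarrow> \<exists>w\<in>N. \<forall>x\<in>N. elts x \<subseteq> elts u \<longrightarrow> x \<in> elts w"
  by (induction N rule: multiverse_induct) (rule generic_extension.weak_power_set_gen_ext)

lemma ktriple_multiverse:
  assumes N: "N \<in> multiverse \<gamma> M" and t: "ktriple P le o1 \<in> N"
  shows "P \<in> N" "o1 \<in> N"
proof -
  have pair: "a \<in> N \<and> b \<in> N" if "kpair a b \<in> N" for a b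
  proof -
    have "hset {a, b} \<in> N"
      by (rule multiverse_trans[OF N that]) (simp add: kpair_def)
    from multiverse_trans[OF N this] show ?thesis by simp
  qed
  show "P \<in> N" "o1 \<in> N"
    using t pair unfolding ktriple_def by blast+
qed

section \<open>Reflexivity of extension and maximality of infinitely generic models\<close>

lemma subset_gen_ext:
  assumes N: "N \<in> multiverse \<gamma> M" and "o1 \<in> N" "o1 \<in> elts P" "o1 \<in> G"
  shows "N \<subseteq> gen_ext N P G"
proof
  fix x assume "x \<in> N"
  then have "chk o1 x \<in> N" "is_name P (chk o1 x)"
    using assms multiverse_chk is_name_chk by auto
  then show "x \<in> gen_ext N P G"
    unfolding gen_ext_def using val_chk[OF assms(4), of x] by force
qed

lemma gen_ext_subset:
  assumes N: "N \<in> multiverse \<gamma> M" and "hset G \<in> N" "countable G"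
  shows "gen_ext N P G \<subseteq> N"
  unfolding gen_ext_def using multiverse_val[OF N assms(2)] assms(3) by auto

text \<open>Used to read a forced negation at the model itself. The filter of the one-point forcing
  lies in N, so adjoining it adds nothing.\<close>

lemma extends_refl:
  assumes N: "N \<in> multiverse \<gamma> M" and adm: "admissible_class \<gamma> M"
  shows "extends \<gamma> N N"
proof -
  let ?o = "hset {}"
  let ?P = "hset {?o}"
  let ?le = "hset {kpair ?o ?o}"
  have triv: "in_class \<gamma> N ?P ?le ?o"
    using assms unfolding admissible_class_def contains_trivial_def by blast
  then have "ktriple ?P ?le ?o \<in> N" by (simp add: in_class_def)
  then have "?P \<in> N" "?o \<in> N" by (rule ktriple_multiverse[OF N])+
  then have "N = gen_ext N ?P {?o}"
    using subset_gen_ext[OF N, of ?o ?P "{?o}"] gen_ext_subset[OF N, of "{?o}" ?P] by simp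
  moreover have "generic_over N ?P ?le ?o {?o}"
    unfolding generic_over_def is_filter_def dense_in_def by auto
  ultimately show ?thesis
    unfolding extends_def using triv by blast
qed

lemma infinitely_generic_maximal:
  assumes adm: "admissible_class \<gamma> M"
    and N: "N \<in> multiverse \<gamma> M" and gen: "infinitely_generic \<gamma> M N"
    and N': "N' \<in> multiverse \<gamma> M" and ext: "extends \<gamma> N' N"
  shows "N' = N"
proof -
  obtain P le o1 G where triple: "ktriple P le o1 \<in> N" and poset: "forcing_notion P le o1"
    and G: "generic_over N P le o1 G" and N'_eq: "N' = gen_ext N P G"
    using ext unfolding extends_def in_class_def by blast
  have P_N: "P \<in> N" "o1 \<in> N"
    using ktriple_multiverse[OF N triple] by auto
  have G_P: "G \<subseteq> elts P" "o1 \<in> G"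
    using G by (auto simp: generic_over_def is_filter_def)
  have cG: "countable G"
    using G_P(1) countable_subset by fastforce
  have N_N': "N \<subseteq> N'"
    unfolding N'_eq by (rule subset_gen_ext[OF N P_N(2)]) (use G_P in auto)
  define \<Gamma> where "\<Gamma> = hset ((\<lambda>q. kpair (chk o1 q) q) ` elts P)"
  have "\<Gamma> \<in> N"
    unfolding \<Gamma>_def by (rule multiverse_canonical_name[OF N P_N(2,1)])
  moreover have "is_name P \<Gamma>"
    by (rule is_name.intros) (use G_P is_name_chk in \<open>auto simp: \<Gamma>_def\<close>)
  moreover have "val G \<Gamma> = hset G"
  proof -
    have "elts (val G \<Gamma>) = {val G (chk o1 q) | q. q \<in> G}"
      using G_P(1) by (simp add: elts_val \<Gamma>_def image_iff) blast
    also have "\<dots> = G" by (simp add: val_chk[OF G_P(2)])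
    finally show ?thesis using cG by (simp add: hc_ext)
  qed
  ultimately have G_N': "hset G \<in> N'"
    unfolding N'_eq gen_ext_def by force
  have "hset G \<in> N"
  proof (rule ccontr)
    assume G_N: "hset G \<notin> N"
    obtain w where w: "w \<in> N" "\<And>x. x \<in> N \<Longrightarrow> elts x \<subseteq> elts P \<Longrightarrow> x \<in> elts w"
      using multiverse_weak_power_set[OF N P_N(1)] by blast
    \<comment> \<open>Under the outer quantifier the indices 0, 1, 2 denote x, P, w; under the inner
      one they denote y, x, P.\<close>
    define \<psi> where "\<psi> = Exi (And (Neg (Exi (And (Mem 0 1) (Neg (Mem 0 2))))) (Neg (Mem 0 2)))"
    define e where "e = case_nat P (\<lambda>_. w)"
    have asg: "assignment_in N e"
      using P_N w by (auto simp: assignment_in_def e_def split: nat.split)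
    have vars: "case_nat x e 0 = x" "case_nat x e 1 = P" "case_nat x e 2 = w"
      "case_nat y (case_nat x e) 0 = y" "case_nat y (case_nat x e) 1 = x"
      "case_nat y (case_nat x e) 2 = P" for x y
      by (simp_all add: e_def numeral_2_eq_2)
    have \<psi>_iff: "mforces \<gamma> M K e \<psi> \<longleftrightarrow> (\<exists>x\<in>K.
        \<not> (\<exists>Q\<in>multiverse \<gamma> M. extends \<gamma> Q K \<and>
          (\<exists>y\<in>Q. y \<in> elts x \<and> \<not> (\<exists>R\<in>multiverse \<gamma> M. extends \<gamma> R Q \<and> y \<in> elts P))) \<and>
        \<not> (\<exists>Q\<in>multiverse \<gamma> M. extends \<gamma> Q K \<and> x \<in> elts w))" for K
      unfolding \<psi>_def by (simp only: mforces.simps sat.simps vars)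
    have "\<not> (hset G \<in> elts w)" using multiverse_trans[OF N w(1)] G_N by blast
    \<comment> \<open>For every Q below N' the elements of G lie in P, and R = Q witnesses this by
      reflexivity.\<close>
    then have "mforces \<gamma> M N' e \<psi>"
      unfolding \<psi>_iff using G_N' extends_refl[OF _ adm] G_P(1) cG
      by (intro bexI[of _ "hset G"]) auto
    then have "\<not> mforces \<gamma> M N e (Neg \<psi>)" using N' ext by auto
    then have "mforces \<gamma> M N e \<psi>"
      using gen asg unfolding infinitely_generic_def by blast
    \<comment> \<open>Both negations are instantiated at Q = N; the statement about R does not
      depend on R.\<close>
    then obtain x where x: "x \<in> N"
      and sub: "\<And>y. y \<in> N \<Longrightarrow> y \<in> elts x \<Longrightarrow> y \<in> elts P" and "x \<notin> elts w"
      unfolding \<psi>_iff using N extends_refl[OF N adm] by blast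
    then show False using w(2) multiverse_trans[OF N x] by blast
  qed
  then show ?thesis
    using gen_ext_subset[OF N _ cG, of P] N_N' N'_eq by auto
qed

end

theorem mainTheorem8:
  fixes M N :: "hc set" and \<gamma> \<phi> :: fm and e :: "nat \<Rightarrow> hc"
  assumes "ctm_ZFC M"
    and "admissible_class \<gamma> M"
    and "sigma_closed \<gamma> M"
    and "N \<in> multiverse \<gamma> M"
    and "infinitely_generic \<gamma> M N"
    and "assignment_in N e"
    and "\<exists>N' \<in> multiverse \<gamma> M. extends \<gamma> N' N \<and> sat N' e \<phi> \<and>
           (\<forall>N'' \<in> multiverse \<gamma> M. extends \<gamma> N'' N' \<longrightarrow> sat N'' e \<phi>)"
  shows "sat N e \<phi>"
  \<comment> \<open>The given N' satisfies \<phi> and equals N by maximality.\<close>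
  using infinitely_generic_maximal[OF assms(1,2,4,5)] assms(7) by blast

end
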